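(* Let $k,l\ge1$. Let $\lambda/\mu$ be a skew partition with $\lambda=(\lambda_1,\ldots,\lambda_{k+1})$, $\mu=(\mu_1,\ldots,\mu_{k+1})$ (parts may be zero), and let $\lambda'=(\lambda'_1,\ldots,\lambda'_{l+1})$, $\mu'=(\mu'_1,\ldots,\mu'_{l+1})$ be their conjugates. Then (1) \begin{align*} &S^{(r)}_{(\lambda_1,\ldots,\lambda_{k+1})/(\mu_1,\ldots,\mu_{k+1})}(X)\, S^{(r-1)}_{(\lambda_2,\ldots,\lambda_k)/(\mu_2,\ldots,\mu_k)}(X)\\ &=S^{(r)}_{(\lambda_1,\ldots,\lambda_k)/(\mu_1,\ldots,\mu_k)}(X)\, S^{(r-1)}_{(\lambda_2,\ldots,\lambda_{k+1})/(\mu_2,\ldots,\mu_{k+1})}(X) -S^{(r)}_{(\lambda_2-1,\ldots,\lambda_{k+1}-1)/(\mu_1,\ldots,\mu_k)}(X)\, S^{(r-1)}_{(\lambda_1+1,\ldots,\lambda_k+1)/(\mu_2,\ldots,\mu_{k+1})}(X); \end{align*} (2) \begin{align*} &S^{(r)}_{(\lambda'_1,\ldots,\lambda'_{l+1})'/(\mu'_1,\ldots,\mu'_{l+1})'}(X)\, S^{(r+1)}_{(\lambda'_2,\ldots,\lambda'_l)'/(\mu'_2,\ldots,\mu'_l)'}(X)\\ &=S^{(r)}_{(\lambda'_1,\ldots,\lambda'_l)'/(\mu'_1,\ldots,\mu'_l)'}(X)\, S^{(r+1)}_{(\lambda'_2,\ldots,\lambda'_{l+1})'/(\mu'_2,\ldots,\mu'_{l+1})'}(X)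 -S^{(r)}_{(\lambda'_2-1,\ldots,\lambda'_{l+1}-1)'/(\mu'_1,\ldots,\mu'_l)'}(X)\, S^{(r+1)}_{(\lambda'_1+1,\ldots,\lambda'_l+1)'/(\mu'_2,\ldots,\mu'_{l+1})'}(X). \end{align*} Here $S^{(r)}_{\lambda/\mu}(X)$ is understood to be $0$ if $\lambda/\mu$ is not a skew partition.
   Context: Let $N$ be a positive integer and $X=[x_{i,j}]_{1\le i,j\le N}$ a matrix of indeterminates. Over $\mathbb{C}(X)$ write the Gauss decomposition $X=X_-X_0X_+$ ($X_-$ lower unitriangular, $X_0$ diagonal, $X_+$ upper unitriangular). For an integer $0\le r\le N$ and partitions $\mu\subset\lambda$ contained in $((N-r)^r)$, let $I=\{\mu_{r+1-a}+a:1\le a\le r\}$, $J=\{\lambda_{r+1-a}+a:1\le a\le r\}$ and let $S^{(r)}_{\lambda/\mu}(X)$ be the minor of $X_+$ with row set $I$ and column set $J$. Partitions are identified with sequences obtained by deleting trailing zeros; $\nu'$ denotes the conjugate of a partition $\nu$. $N$ is assumed large enough that all quantities appearing are defined. *)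

theory Defs
  imports
    "HOL-Library.Poly_Mapping"
    "HOL-Library.Product_Lexorder"
    "HOL-Computational_Algebra.Fraction_Field"
    "Jordan_Normal_Form.Determinant"
    "Jordan_Normal_Form.DL_Submatrix"
    Complex_Main
begin

text \<open>
  The rational function field over the complex numbers in indeterminates indexed by pairs
  of natural numbers.  Monomials are finitely supported exponent functions.  The type provides
  all pairs; the generic matrix of size N uses only those with both indices in 1..N.
  The lexicographic order on pairs only serves to obtain the integral domain instance.
\<close>

type_synonym ratfun = "((nat \<times> nat \<Rightarrow>\<^sub>0 nat) \<Rightarrow>\<^sub>0 complex) fract"

definition indet :: "nat \<Rightarrow> nat \<Rightarrow> ratfun" where
  "indet i j = Fract (Poly_Mapping.single (Poly_Mapping.single (i, j) 1) 1) 1"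

text \<open>Matrix positions of the library are counted from 0, mathematical indices from 1.\<close>

definition generic_mat :: "nat \<Rightarrow> ratfun mat" where
  "generic_mat N = mat N N (\<lambda>(i, j). indet (i + 1) (j + 1))"

definition upper_unitriangular :: "'a::{zero,one} mat \<Rightarrow> bool" where
  "upper_unitriangular A \<longleftrightarrow> upper_triangular A \<and> (\<forall>i<dim_row A. A $$ (i, i) = 1)"

definition gauss_decomposition :: "'a::field mat \<Rightarrow> 'a mat \<Rightarrow> 'a mat \<Rightarrow> 'a mat \<Rightarrow> bool" where
  "gauss_decomposition X Xm X0 Xp \<longleftrightarrow>
     (let n = dim_row X in
        Xm \<in> carrier_mat n n \<and> X0 \<in> carrier_mat n n \<and> Xp \<in> carrier_mat n n \<and>
        upper_unitriangular (transpose_mat Xm) \<and> diagonal_mat X0 \<and> upper_unitriangular Xp \<and>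
        X = Xm * X0 * Xp)"

text \<open>
  The factor \<open>X\<^sub>+\<close>.  The description is meaningful when the decomposition exists and its last
  factor is unique, which is the case if all leading principal minors are nonzero, in
  particular for the generic matrix.
\<close>

definition gauss_upper :: "'a::field mat \<Rightarrow> 'a mat" where
  "gauss_upper X = (THE Xp. \<exists>Xm X0. gauss_decomposition X Xm X0 Xp)"

text \<open>
  Integer sequences are lists, read as extended by zeros; \<open>part \<nu> i\<close> is the i-th entry, counted
  from 1.  Entries may be negative, since decreasing the parts of a partition by one can
  leave the set of partitions.
\<close>

definition part :: "int list \<Rightarrow> nat \<Rightarrow> int" where
  "part \<nu> i = (if 1 \<le> i \<and> i \<le> length \<nu> then \<nu> ! (i - 1) else 0)"

text \<open>The sequence \<open>(f a, \<dots>, f b)\<close>, empty if \<open>b < a\<close>.\<close>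

definition seq :: "(nat \<Rightarrow> int) \<Rightarrow> nat \<Rightarrow> nat \<Rightarrow> int list" where
  "seq f a b = map f [a..<b + 1]"

definition is_partition :: "int list \<Rightarrow> bool" where
  "is_partition \<nu> \<longleftrightarrow> sorted_wrt (\<ge>) \<nu> \<and> (\<forall>x\<in>set \<nu>. 0 \<le> x)"

definition contained :: "int list \<Rightarrow> int list \<Rightarrow> bool" where
  "contained \<mu> \<nu> \<longleftrightarrow> (\<forall>i\<ge>1. part \<mu> i \<le> part \<nu> i)"

definition is_skew :: "int list \<Rightarrow> int list \<Rightarrow> bool" where
  "is_skew \<nu> \<mu> \<longleftrightarrow> is_partition \<nu> \<and> is_partition \<mu> \<and> contained \<mu> \<nu>"

text \<open>
  Conjugate partition.  A sequence that is not a partition has no conjugate; it is returned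
  unchanged, so that the result is not a partition either and a skew minor formed with it
  is 0.
\<close>

definition conj_seq :: "int list \<Rightarrow> int list" where
  "conj_seq \<nu> =
     (if is_partition \<nu>
      then map (\<lambda>j. int (card {i. 1 \<le> i \<and> int j \<le> part \<nu> i})) [1..<nat (part \<nu> 1) + 1]
      else \<nu>)"

text \<open>The minor with row set I and column set J, both subsets of 1..N.\<close>

definition minor :: "'a::comm_ring_1 mat \<Rightarrow> nat set \<Rightarrow> nat set \<Rightarrow> 'a" where
  "minor A I J = det (submatrix A ((\<lambda>i. i - 1) ` I) ((\<lambda>j. j - 1) ` J))"

definition index_set :: "nat \<Rightarrow> int list \<Rightarrow> nat set" where
  "index_set r \<nu> = (\<lambda>a. nat (part \<nu> (r + 1 - a) + int a)) ` {1..r}"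

definition S :: "'a::field mat \<Rightarrow> nat \<Rightarrow> int list \<Rightarrow> int list \<Rightarrow> 'a" where
  "S X r \<nu> \<mu> =
     (if is_skew \<nu> \<mu> then minor (gauss_upper X) (index_set r \<mu>) (index_set r \<nu>) else 0)"

text \<open>
  When \<open>S X r \<nu> \<mu>\<close> is defined for X of size N: \<open>0 \<le> r \<le> N\<close>, and \<open>\<nu>\<close> lies in the r by N - r
  rectangle (then so does \<open>\<mu>\<close>) unless the value is 0 by convention.
\<close>

definition S_defined :: "nat \<Rightarrow> nat \<Rightarrow> int list \<Rightarrow> int list \<Rightarrow> bool" where
  "S_defined N r \<nu> \<mu> \<longleftrightarrow>
     r \<le> N \<and> (is_skew \<nu> \<mu> \<longrightarrow> contained \<nu> (replicate r (int (N - r))))"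

end

theory Submission
  imports Defs "Jordan_Normal_Form.Char_Poly"
begin

text \<open>
  Let \<open>U = X\<^sub>+\<close>. Both identities are the Desnanot--Jacobi identity
  \<open>det M det M\<^bsub>{a,a'},{b,b'}\<^esub> = det M\<^bsub>a,b\<^esub> det M\<^bsub>a',b'\<^esub> - det M\<^bsub>a,b'\<^esub> det M\<^bsub>a',b\<^esub>\<close>
  (the subscripts list deleted rows and columns) for a submatrix \<open>M\<close> of \<open>U\<close>.
  Since \<open>U\<close> is unitriangular, a minor does not change when a common initial or final segment is
  added to both index sets, so the zero parts of a partition can be ignored.
  For (1), \<open>M\<close> has the rows \<open>\<mu>\<^sub>i - i + r + 1\<close> and columns \<open>\<lambda>\<^sub>i - i + r + 1\<close> with \<open>i \<le> k + 1\<close>, and the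
  extreme ones are deleted.
  For (2), the index set of \<open>\<nu>'\<close> in \<open>{1..n}\<close> is the complement of the numbers \<open>r + j - \<nu>\<^sub>j\<close>.
  Deleting parts of \<open>\<nu>\<close> enlarges the minor, and \<open>M\<close> is the minor with \<open>2 \<le> j \<le> l\<close>.
  Finally, when \<open>\<lambda>/\<mu>\<close> is not a skew partition, the corresponding minor of \<open>U\<close> has a zero block
  that forces it to vanish.
\<close>

subsection \<open>The Desnanot--Jacobi identity\<close>

text \<open>In the Leibniz sum a permutation that moves an index outside \<open>{j, j'}\<close>
  picks an off-diagonal zero of a unit column, so only the identity and the transposition of
  \<open>j\<close> and \<open>j'\<close> survive.\<close>

lemma det_identity_two_columns:
  fixes u v :: "nat \<Rightarrow> 'a::comm_ring_1"
  assumes "j < j'" "j' < n"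
  shows "det (mat n n (\<lambda>(a, b). if b = j then u a else if b = j' then v a
      else if a = b then 1 else 0)) = u j * v j' - u j' * v j" (is "det ?B = _")
proof -
  let ?t = "Transposition.transpose j j'"
  let ?f = "\<lambda>p. signof p * (\<Prod>b<n. ?B $$ (p b, b))"
  have t: "?t permutes {0..<n}"
    using assms by (intro permutes_swap_id) auto
  have ne: "id \<noteq> ?t"
    using assms by (metis id_apply transpose_apply_first less_irrefl)
  have "det ?B = (\<Sum>p | p permutes {0..<n}. ?f p)"
    by (rule det_col) simp
  also have "\<dots> = (\<Sum>p\<in>{id, ?t}. ?f p)"
  proof (rule sum.mono_neutral_right)
    show "\<forall>p\<in>{p. p permutes {0..<n}} - {id, ?t}. ?f p = 0"
    proof
      fix p assume p: "p \<in> {p. p permutes {0..<n}} - {id, ?t}"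
      then have per: "p permutes {0..<n}" by simp
      \<comment> \<open>Otherwise \<open>p\<close> would restrict to a permutation of
        \<open>{j, j'}\<close> and be one of the two excluded ones.\<close>
      have "\<exists>b<n. b \<noteq> j \<and> b \<noteq> j' \<and> p b \<noteq> b"
      proof (rule ccontr)
        assume "\<not> ?thesis"
        then have fix_out: "p b = b" if "b \<noteq> j" "b \<noteq> j'" for b
          using that per by (metis permutes_not_in atLeastLessThan_iff zero_le)
        have "p permutes {j, j'}"
          using fix_out permutes_bij[OF per]
          unfolding permutes_def bij_iff by auto
        then have "p = id \<or> p = ?t"
          by (simp add: permutes_doubleton_iff)
        then show False using p by auto
      qed
      then obtain b where b: "b < n" "b \<noteq> j" "b \<noteq> j'" "p b \<noteq> b" by auto
      have "p b < n" using per b(1) permutes_in_image by fastforce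
      then have "?B $$ (p b, b) = 0" using b by simp
      then have "(\<Prod>b<n. ?B $$ (p b, b)) = 0"
        using b(1) by (intro prod_zero) auto
      then show "?f p = 0" by simp
    qed
  qed (use t permutes_id in \<open>auto simp: finite_permutations\<close>)
  also have "\<dots> = ?f id + ?f ?t" using ne by simp
  also have "(\<Prod>b<n. ?B $$ (id b, b)) = u j * v j'"
  proof -
    have "(\<Prod>b<n. ?B $$ (id b, b)) = (\<Prod>b\<in>{j, j'}. ?B $$ (id b, b))"
      using assms by (intro prod.mono_neutral_right) auto
    then show ?thesis using assms by simp
  qed
  also have "(\<Prod>b<n. ?B $$ (?t b, b)) = u j' * v j"
  proof -
    have "(\<Prod>b<n. ?B $$ (?t b, b)) = (\<Prod>b\<in>{j, j'}. ?B $$ (?t b, b))"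
      using assms by (intro prod.mono_neutral_right) (auto simp: transpose_def)
    then show ?thesis using assms by simp
  qed
  finally show ?thesis using assms by (simp add: sign_swap_id sign_id)
qed

lemma det_unit_column:
  fixes A :: "'a::comm_ring_1 mat"
  assumes "A \<in> carrier_mat n n" "i < n" "j < n"
    and "\<And>a. a < n \<Longrightarrow> A $$ (a, j) = (if a = i then c else 0)"
  shows "det A = c * (-1) ^ (i + j) * det (mat_delete A i j)"
proof -
  have "det A = (\<Sum>a<n. A $$ (a, j) * cofactor A a j)"
    using assms by (intro laplace_expansion_column)
  also have "\<dots> = (\<Sum>a<n. if a = i then c * cofactor A a j else 0)"
    using assms by (intro sum.cong) auto
  also have "\<dots> = c * cofactor A i j" using assms by simp
  finally show ?thesis by (simp add: cofactor_def mult.assoc)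
qed

text \<open>Jacobi's argument: \<open>M\<close> is multiplied by the identity matrix whose columns
  \<open>j\<close> and \<open>j'\<close> are replaced by the columns \<open>i\<close> and
  \<open>i'\<close> of the adjugate. The product has multiples of unit vectors in these two columns
  and agrees with \<open>M\<close> elsewhere; its determinant is computed in two ways.\<close>

lemma desnanot_jacobi_nonsingular:
  fixes M :: "'a::idom mat"
  assumes M: "M \<in> carrier_mat n n" and ij: "i < i'" "i' < n" "j < j'" "j' < n"
    and nz: "det M \<noteq> 0"
  shows "det M * det (mat_delete (mat_delete M i' j') i j) =
    det (mat_delete M i j) * det (mat_delete M i' j') -
    det (mat_delete M i j') * det (mat_delete M i' j)"
proof -
  define d where "d = det M"
  define B where "B = mat n n (\<lambda>(a, b). if b = j then adj_mat M $$ (a, i)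
      else if b = j' then adj_mat M $$ (a, i') else if a = b then 1 else 0)"
  define P where "P = M * B"
  have B: "B \<in> carrier_mat n n" unfolding B_def by simp
  have P: "P \<in> carrier_mat n n" unfolding P_def using M B by simp
  \<comment> \<open>\<open>M * adj_mat M\<close> is \<open>d\<close> times the identity, so this
    column of \<open>P\<close> is \<open>d\<close> times the \<open>i\<close>-th unit
    vector.\<close>
  have Pj: "P $$ (a, b) = (if a = i then d else 0)" if "a < n" "b = j" for a b
  proof -
    have "P $$ (a, j) = row M a \<bullet> col B j" unfolding P_def using that ij M B by simp
    also have "col B j = col (adj_mat M) i"
      using ij M by (intro eq_vecI) (auto simp: B_def adj_mat_def)
    also have "row M a \<bullet> col (adj_mat M) i = (M * adj_mat M) $$ (a, i)"
      using that ij M adj_mat(1)[OF M] by simp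
    finally show ?thesis unfolding adj_mat(2)[OF M] d_def using that ij by simp
  qed
  have Pj': "P $$ (a, b) = (if a = i' then d else 0)" if "a < n" "b = j'" for a b
  proof -
    have "P $$ (a, j') = row M a \<bullet> col B j'" unfolding P_def using that ij M B by simp
    also have "col B j' = col (adj_mat M) i'"
      using ij M by (intro eq_vecI) (auto simp: B_def adj_mat_def)
    also have "row M a \<bullet> col (adj_mat M) i' = (M * adj_mat M) $$ (a, i')"
      using that ij M adj_mat(1)[OF M] by simp
    finally show ?thesis unfolding adj_mat(2)[OF M] d_def using that ij by simp
  qed
  have Pb: "P $$ (a, b) = M $$ (a, b)" if "a < n" "b < n" "b \<noteq> j" "b \<noteq> j'" for a b
  proof -
    have "P $$ (a, b) = row M a \<bullet> col B b" unfolding P_def using that M B by simp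
    also have "col B b = col (1\<^sub>m n) b"
      using that by (intro eq_vecI) (auto simp: B_def)
    also have "row M a \<bullet> col (1\<^sub>m n) b = (M * 1\<^sub>m n) $$ (a, b)"
      using that M by simp
    finally show ?thesis using M by simp
  qed
  \<comment> \<open>The larger indices are deleted first, so that \<open>i\<close> and
    \<open>j\<close> keep their positions in \<open>Q\<close>.\<close>
  define Q where "Q = mat_delete P i' j'"
  have Q: "Q \<in> carrier_mat (n - 1) (n - 1)" unfolding Q_def using P by (rule mat_delete_carrier)
  have "det P = d * (-1) ^ (i' + j') * det Q"
    unfolding Q_def using P ij Pj' by (intro det_unit_column) auto
  also have "det Q = d * (-1) ^ (i + j) * det (mat_delete Q i j)"
    using ij P by (intro det_unit_column[OF Q]) (auto simp: Q_def mat_delete_def Pj)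
  also have "mat_delete Q i j = mat_delete (mat_delete M i' j') i j"
    using P M ij unfolding Q_def
    by (intro eq_matI) (auto simp: mat_delete_def Pb)
  finally have 1: "det P = d * (d * ((-1) ^ (i + j + i' + j') * det (mat_delete (mat_delete M i' j') i j)))"
    by (simp add: power_add mult_ac)
  \<comment> \<open>A 2 by 2 minor of the adjugate; its entry at \<open>(j, i)\<close> is the
    cofactor of \<open>M\<close> at row \<open>i\<close> and column \<open>j\<close>.\<close>
  have "det B = adj_mat M $$ (j, i) * adj_mat M $$ (j', i') - adj_mat M $$ (j', i) * adj_mat M $$ (j, i')"
    unfolding B_def using ij by (intro det_identity_two_columns) auto
  also have "\<dots> = (-1) ^ (i + j + i' + j') *
     (det (mat_delete M i j) * det (mat_delete M i' j') - det (mat_delete M i j') * det (mat_delete M i' j))"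
    using M ij by (simp add: adj_mat_def cofactor_def power_add algebra_simps)
  finally have 2: "det P = d * ((-1) ^ (i + j + i' + j') *
     (det (mat_delete M i j) * det (mat_delete M i' j') - det (mat_delete M i j') * det (mat_delete M i' j)))"
    unfolding P_def det_mult[OF M B] d_def by simp
  \<comment> \<open>Both evaluations contain the same sign and a factor \<open>d\<close>, which
    cancels because \<open>det M\<close> is nonzero.\<close>
  show ?thesis
    using 1 2 nz unfolding d_def by simp
qed

lemma map_mat_delete:
  assumes "A \<in> carrier_mat n n" "i < n" "j < n"
  shows "map_mat f (mat_delete A i j) = mat_delete (map_mat f A) i j"
  using assms by (intro eq_matI) (auto simp: mat_delete_def)

text \<open>A singular matrix is perturbed to \<open>M + x I\<close> over the polynomial ring.\<close>

theorem desnanot_jacobi: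
  fixes M :: "'a::idom mat"
  assumes M: "M \<in> carrier_mat n n" and ij: "i < i'" "i' < n" "j < j'" "j' < n"
  shows "det M * det (mat_delete (mat_delete M i' j') i j) =
    det (mat_delete M i j) * det (mat_delete M i' j') -
    det (mat_delete M i j') * det (mat_delete M i' j)"
proof -
  \<comment> \<open>This is the matrix \<open>x I + M\<close>, which specializes to \<open>M\<close>
    at \<open>x = 0\<close>.\<close>
  define C where "C = char_poly_matrix (- M)"
  have ev: "comm_ring_hom (\<lambda>p::'a poly. poly p 0)"
    by unfold_locales auto
  have C: "C \<in> carrier_mat n n" unfolding C_def using M by simp
  have MC: "M = map_mat (\<lambda>p. poly p 0) C"
    using M by (intro eq_matI) (auto simp: C_def char_poly_matrix_def)
  \<comment> \<open>The determinant is the characteristic polynomial of \<open>- M\<close>, which is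
    monic.\<close>
  have "det C \<noteq> 0"
    using degree_monic_char_poly[of "- M" n] M unfolding C_def char_poly_def by auto
  from arg_cong[OF desnanot_jacobi_nonsingular[OF C ij this], of "\<lambda>p. poly p 0"]
  show ?thesis
    using ij unfolding MC
    by (simp add: map_mat_delete[OF C, symmetric] comm_ring_hom.hom_det[OF ev]
       map_mat_delete[OF mat_delete_carrier[OF C], symmetric])
qed

subsection \<open>Minors indexed by sets\<close>

lemma bij_betw_pick:
  assumes "finite I"
  shows "bij_betw (pick I) {..<card I} I"
proof -
  have "inj_on (pick I) {..<card I}"
  proof (rule linorder_inj_onI')
    fix i j assume "i \<in> {..<card I}" "j \<in> {..<card I}" "i < j"
    then show "pick I i \<noteq> pick I j" using pick_mono_le[of j I i] by auto
  qed
  moreover have "pick I ` {..<card I} \<subseteq> I" using pick_in_set_le by auto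
  ultimately show ?thesis using assms
    by (metis bij_betw_imageI card_image card_lessThan card_subset_eq)
qed

text \<open>\<open>pick\<close> is inverse to counting smaller elements, so it suffices to count the
  elements of \<open>I - {pick I i}\<close> below the claimed value: the removed element lowers the
  count exactly when it is smaller.\<close>

lemma pick_remove:
  assumes "i < card I" "k < card I - 1"
  shows "pick (I - {pick I i}) k = pick I (if k < i then k else Suc k)"
proof -
  let ?k = "if k < i then k else Suc k"
  let ?x = "pick I ?k" and ?y = "pick I i"
  have k: "?k < card I" using assms by auto
  have fin: "finite I" using assms card.infinite by fastforce
  have x: "?x \<in> I" using k by (rule pick_in_set_le)
  have xy: "?x < ?y \<longleftrightarrow> k < i" "?x \<noteq> ?y"
    using pick_mono_le[of i I k] pick_mono_le[of "Suc k" I i] assms k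
    by (auto split: if_splits)
  have "card {a \<in> I - {?y}. a < ?x} = card ({a \<in> I. a < ?x} - {?y})"
    by (rule arg_cong[of _ _ card]) auto
  also have "\<dots> = ?k - (if ?y < ?x then 1 else 0)"
    using pick_in_set_le[OF assms(1)] card_pick_le[OF k] fin
    by (simp add: card_Diff_singleton_if)
  also have "\<dots> = k" using xy by auto
  finally have "pick (I - {?y}) k = pick (I - {?y}) (card {a \<in> I - {?y}. a < ?x})" by simp
  also have "\<dots> = ?x" using x xy by (intro pick_card_in_set) auto
  finally show ?thesis .
qed

text \<open>The index sets count from 0 here, in contrast to those of \<open>minor\<close>.\<close>

definition subdet :: "'a::comm_ring_1 mat \<Rightarrow> nat set \<Rightarrow> nat set \<Rightarrow> 'a" where
  "subdet A I J = det (submatrix A I J)"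

lemma submatrix_eq_mat:
  assumes "A \<in> carrier_mat n m" "I \<subseteq> {..<n}" "J \<subseteq> {..<m}"
  shows "submatrix A I J = mat (card I) (card J) (\<lambda>(i, j). A $$ (pick I i, pick J j))"
proof -
  have "{i. i < dim_row A \<and> i \<in> I} = I" "{j. j < dim_col A \<and> j \<in> J} = J"
    using assms by auto
  then show ?thesis unfolding submatrix_def by simp
qed

lemma mat_delete_submatrix:
  assumes "A \<in> carrier_mat n m" "I \<subseteq> {..<n}" "J \<subseteq> {..<m}" "i < card I" "j < card J"
  shows "mat_delete (submatrix A I J) i j = submatrix A (I - {pick I i}) (J - {pick J j})"
proof -
  have "I - {pick I i} \<subseteq> {..<n}" "J - {pick J j} \<subseteq> {..<m}"
    using assms by auto
  moreover have "card (I - {pick I i}) = card I - 1" "card (J - {pick J j}) = card J - 1"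
    using assms pick_in_set_le by (auto simp: card_Diff_singleton)
  ultimately show ?thesis
    unfolding submatrix_eq_mat[OF assms(1-3)]
    using assms by (intro eq_matI)
      (auto simp: mat_delete_def pick_remove submatrix_eq_mat[OF assms(1)])
qed

lemma position_less_card:
  assumes "finite I" "(a::nat) \<in> I"
  shows "card {x \<in> I. x < a} < card I"
  using assms by (intro psubset_card_mono) auto

text \<open>Passes from positions to elements: the position of an element in its index set is the
  number of smaller elements.\<close>

lemma mat_delete_submatrix_position:
  assumes "A \<in> carrier_mat n m" "I \<subseteq> {..<n}" "J \<subseteq> {..<m}" "a \<in> I" "b \<in> J"
  shows "mat_delete (submatrix A I J) (card {x \<in> I. x < a}) (card {x \<in> J. x < b}) =
    submatrix A (I - {a}) (J - {b})"
proof -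
  have fin: "finite I" "finite J" using assms finite_subset by blast+
  show ?thesis
    using mat_delete_submatrix[OF assms(1-3) position_less_card[OF fin(1) assms(4)]
        position_less_card[OF fin(2) assms(5)]]
    by (simp add: pick_card_in_set assms)
qed

theorem desnanot_jacobi_subdet:
  fixes A :: "'a::idom mat"
  assumes A: "A \<in> carrier_mat n m" and IJ: "I \<subseteq> {..<n}" "J \<subseteq> {..<m}" "card I = card J"
    and a: "a \<in> I" "a' \<in> I" "a < a'" and b: "b \<in> J" "b' \<in> J" "b < b'"
  shows "subdet A I J * subdet A (I - {a, a'}) (J - {b, b'}) =
    subdet A (I - {a}) (J - {b}) * subdet A (I - {a'}) (J - {b'}) -
    subdet A (I - {a}) (J - {b'}) * subdet A (I - {a'}) (J - {b})"
proof -
  let ?p = "\<lambda>I a. card {x \<in> I. x < a}"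
  let ?M = "submatrix A I J"
  have fin: "finite I" "finite J" using IJ finite_subset by blast+
  have M: "?M \<in> carrier_mat (card I) (card I)"
    unfolding submatrix_eq_mat[OF A IJ(1,2)] using IJ by simp
  have less: "?p I a < ?p I a'" "?p J b < ?p J b'"
    using a b fin by (auto intro!: psubset_card_mono)
  have bound: "?p I a' < card I" "?p J b' < card I"
    using position_less_card fin a b IJ(3) by metis+
  \<comment> \<open>Removing the larger element does not move the smaller one, so the second of two
    nested deletions still takes place at the original position.\<close>
  have eq: "?p (I - {a'}) a = ?p I a" "?p (J - {b'}) b = ?p J b"
    using a b by (auto intro!: arg_cong[of _ _ card])
  have sub: "I - {a'} \<subseteq> {..<n}" "J - {b'} \<subseteq> {..<m}" using IJ by auto
  have "mat_delete (submatrix A (I - {a'}) (J - {b'})) (?p I a) (?p J b) =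
      submatrix A (I - {a'} - {a}) (J - {b'} - {b})"
    using mat_delete_submatrix_position[OF A sub, of a b] a b unfolding eq by simp
  moreover have "I - {a'} - {a} = I - {a, a'}" "J - {b'} - {b} = J - {b, b'}" by auto
  ultimately show ?thesis
    using desnanot_jacobi[OF M less(1) bound(1) less(2) bound(2)] a b
    by (simp add: subdet_def mat_delete_submatrix_position[OF A IJ(1,2)])
qed

section \<open>Vanishing and reduction of minors of triangular matrices\<close>

lemma card_pick_ge:
  assumes "finite I"
  shows "card {i. i < card I \<and> t \<le> pick I i} = card {x \<in> I. t \<le> x}"
proof -
  have "pick I ` {i. i < card I \<and> t \<le> pick I i} = {x \<in> I. t \<le> x}"
    using bij_betw_imp_surj_on[OF bij_betw_pick[OF assms]] by auto
  moreover have "inj_on (pick I) {i. i < card I \<and> t \<le> pick I i}"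
    using bij_betw_imp_inj_on[OF bij_betw_pick[OF assms]] by (rule inj_on_subset) auto
  ultimately show ?thesis by (metis card_image)
qed

text \<open>Rows with index at least \<open>t\<close> vanish outside the columns with index at least \<open>t\<close>; if there
  are more such rows than such columns, no permutation avoids the zeros.\<close>

lemma subdet_upper_triangular_eq_0:
  assumes U: "U \<in> carrier_mat n n" "upper_triangular U"
    and IJ: "I \<subseteq> {..<n}" "J \<subseteq> {..<n}" "card I = card J"
    and less: "card {j \<in> J. t \<le> j} < card {i \<in> I. t \<le> i}"
  shows "subdet U I J = 0"
proof -
  let ?M = "submatrix U I J"
  have fin: "finite I" "finite J" using IJ finite_subset by blast+
  have Me: "?M = mat (card I) (card I) (\<lambda>(i, j). U $$ (pick I i, pick J j))"
    unfolding submatrix_eq_mat[OF U(1) IJ(1,2)] using IJ(3) by simp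
  have "signof p * (\<Prod>i=0..<card I. ?M $$ (i, p i)) = 0" if p: "p permutes {0..<card I}" for p
  proof -
    let ?R = "{i. i < card I \<and> t \<le> pick I i}" and ?C = "{j. j < card J \<and> t \<le> pick J j}"
    \<comment> \<open>Pigeonhole: \<open>p\<close> is injective and, by \<open>less\<close>, there
      are more row positions in \<open>?R\<close> than column positions in
      \<open>?C\<close>.\<close>
    have "\<not> p ` ?R \<subseteq> ?C"
    proof
      assume "p ` ?R \<subseteq> ?C"
      moreover have "inj_on p ?R" using permutes_inj[OF p] by (rule inj_on_subset) auto
      ultimately have "card ?R \<le> card ?C" by (intro card_inj_on_le) auto
      then show False using less unfolding card_pick_ge[OF fin(1)] card_pick_ge[OF fin(2)] by simp
    qed
    then obtain i where i: "i < card I" "t \<le> pick I i" "p i \<notin> ?C" by auto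
    have pi: "p i < card I" using permutes_in_image[OF p, of i] i by simp
    \<comment> \<open>The column index is below \<open>t\<close> and the row index is not, so the
      entry lies strictly below the diagonal of \<open>U\<close>.\<close>
    then have "pick J (p i) < pick I i" using i IJ(3) by auto
    moreover have "pick I i < n" using pick_in_set_le[OF i(1)] IJ(1) by auto
    ultimately have "?M $$ (i, p i) = 0" using i(1) pi U unfolding Me by auto
    then have "(\<Prod>i=0..<card I. ?M $$ (i, p i)) = 0"
      using i(1) by (intro prod_zero) auto
    then show ?thesis by simp
  qed
  then show ?thesis
    unfolding subdet_def by (subst det_def'[of _ "card I"]) (auto simp: Me)
qed

lemma pick_eq_iff_position:
  assumes "finite I" "i < card I" "c \<in> I"
  shows "pick I i = c \<longleftrightarrow> i = card {x \<in> I. x < c}"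
  using assms card_pick_le pick_card_in_set by metis

text \<open>Column \<open>c\<close> of \<open>U\<close> is zero below its diagonal entry 1. As
  \<open>c\<close> is the smallest index on both sides, the first column of the enlarged submatrix
  is the first unit vector, and expansion along it removes \<open>c\<close>.\<close>

lemma subdet_insert_min:
  assumes U: "U \<in> carrier_mat n n" "upper_unitriangular U"
    and IJ: "I \<subseteq> {..<n}" "J \<subseteq> {..<n}" "card I = card J"
    and c: "c < n" "\<forall>i\<in>I. c < i" "\<forall>j\<in>J. c < j"
  shows "subdet U (insert c I) (insert c J) = subdet U I J"
proof -
  let ?I = "insert c I" and ?J = "insert c J"
  have sub: "?I \<subseteq> {..<n}" "?J \<subseteq> {..<n}" using IJ c by auto
  have fin: "finite I" "finite J" using IJ finite_subset by blast+
  have cn: "c \<notin> I" "c \<notin> J" using c by auto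
  have pos: "{x \<in> ?I. x < c} = {}" "{x \<in> ?J. x < c} = {}" using c by auto
  let ?M = "submatrix U ?I ?J"
  have Me: "?M = mat (card ?I) (card ?I) (\<lambda>(i, j). U $$ (pick ?I i, pick ?J j))"
    unfolding submatrix_eq_mat[OF U(1) sub] using IJ(3) fin cn by simp
  have pJ: "pick ?J 0 = c" using pick_card_in_set[of c ?J, OF insertI1] unfolding pos by simp
  have "?M $$ (i, 0) = (if i = 0 then 1 else 0)" if "i < card ?I" for i
  proof (cases "i = 0")
    case True
    then have "pick ?I i = c" using pick_card_in_set[of c ?I, OF insertI1] unfolding pos by simp
    then show ?thesis using True that pJ U c unfolding Me upper_unitriangular_def by auto
  next
    case False
    then have "pick ?I i \<noteq> c"
      using pick_eq_iff_position[of ?I i c] fin that unfolding pos by simp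
    moreover have "pick ?I i \<in> ?I" using that by (rule pick_in_set_le)
    ultimately have "c < pick ?I i" "pick ?I i < n" using c IJ by auto
    then show ?thesis using False that pJ U unfolding Me upper_unitriangular_def by auto
  qed
  then have "det ?M = 1 * (-1) ^ (0 + 0) * det (mat_delete ?M 0 0)"
    using fin cn by (intro det_unit_column[of _ "card ?I"]) (auto simp: Me)
  also have "mat_delete ?M 0 0 = submatrix U (?I - {c}) (?J - {c})"
    using mat_delete_submatrix_position[OF U(1) sub, of c c] unfolding pos by simp
  finally show ?thesis using cn unfolding subdet_def by simp
qed

text \<open>Dual to the previous reduction: row \<open>c\<close> of \<open>U\<close> is zero to the
  left of its diagonal entry 1, so the last row of the enlarged submatrix is the last unit
  vector.\<close>

lemma subdet_insert_max:
  assumes U: "U \<in> carrier_mat n n" "upper_unitriangular U"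
    and IJ: "I \<subseteq> {..<n}" "J \<subseteq> {..<n}" "card I = card J"
    and c: "c < n" "\<forall>i\<in>I. i < c" "\<forall>j\<in>J. j < c"
  shows "subdet U (insert c I) (insert c J) = subdet U I J"
proof -
  let ?I = "insert c I" and ?J = "insert c J"
  let ?r = "card I"
  have sub: "?I \<subseteq> {..<n}" "?J \<subseteq> {..<n}" using IJ c by auto
  have fin: "finite I" "finite J" using IJ finite_subset by blast+
  have cn: "c \<notin> I" "c \<notin> J" using c by auto
  have pos: "{x \<in> ?I. x < c} = I" "{x \<in> ?J. x < c} = J" using c by auto
  have card: "card ?I = Suc ?r" "card ?J = Suc ?r" using IJ(3) fin cn by auto
  let ?M = "submatrix U ?I ?J"
  have Me: "?M = mat (Suc ?r) (Suc ?r) (\<lambda>(i, j). U $$ (pick ?I i, pick ?J j))"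
    unfolding submatrix_eq_mat[OF U(1) sub] card by simp
  have pI: "pick ?I ?r = c" using pick_card_in_set[of c ?I] pos by simp
  \<comment> \<open>The transpose turns the expansion along the last row into one along a
    column.\<close>
  have "?M\<^sup>T $$ (j, ?r) = (if j = ?r then 1 else 0)" if "j < Suc ?r" for j
  proof (cases "j = ?r")
    case True
    then have "pick ?J j = c" using pick_card_in_set[of c ?J] pos IJ(3) by simp
    then show ?thesis using True that pI U c unfolding Me upper_unitriangular_def by auto
  next
    case False
    then have "pick ?J j \<noteq> c"
      using pick_eq_iff_position[of ?J j c] fin that pos card IJ(3) by auto
    moreover have "pick ?J j \<in> ?J" using that card(2) by (intro pick_in_set_le) simp
    ultimately have "pick ?J j < c" using c by auto
    then show ?thesis using False that pI U c unfolding Me upper_unitriangular_def by auto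
  qed
  then have "det (?M\<^sup>T) = 1 * (-1) ^ (?r + ?r) * det (mat_delete (?M\<^sup>T) ?r ?r)"
    by (intro det_unit_column[of _ "Suc ?r"]) (auto simp: Me)
  moreover have "mat_delete (?M\<^sup>T) ?r ?r = (mat_delete ?M ?r ?r)\<^sup>T"
    unfolding Me by (intro eq_matI) (auto simp: mat_delete_def)
  moreover have "mat_delete ?M ?r ?r = submatrix U (?I - {c}) (?J - {c})"
    using mat_delete_submatrix_position[OF U(1) sub, of c c] unfolding pos IJ(3) by simp
  moreover have "det (?M\<^sup>T) = det ?M"
    by (rule det_transpose[of _ "Suc ?r"]) (simp add: Me)
  moreover have "det ((mat_delete ?M ?r ?r)\<^sup>T) = det (mat_delete ?M ?r ?r)"
    by (rule det_transpose[of _ ?r]) (simp add: Me mat_delete_def)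
  ultimately show ?thesis using cn unfolding subdet_def by simp
qed

text \<open>The largest element \<open>b\<close> of the segment is moved into \<open>I\<close> and
  \<open>J\<close>. The rest of the segment lies below the enlarged sets, so the induction
  hypothesis removes it, and then \<open>b\<close> goes as the common minimum.\<close>

lemma subdet_union_below:
  assumes U: "U \<in> carrier_mat n n" "upper_unitriangular U"
    and K: "finite K" "K \<subseteq> {..<n}"
    and IJ: "I \<subseteq> {..<n}" "J \<subseteq> {..<n}" "card I = card J"
    and less: "\<forall>c\<in>K. \<forall>i\<in>I \<union> J. c < i"
  shows "subdet U (K \<union> I) (K \<union> J) = subdet U I J"
  using K IJ less
proof (induction K arbitrary: I J rule: finite_linorder_max_induct)
  case (insert b K)
  have fin: "finite I" "finite J" using insert.prems finite_subset by blast+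
  have "subdet U (K \<union> insert b I) (K \<union> insert b J) = subdet U (insert b I) (insert b J)"
    using insert.prems insert.hyps fin by (intro insert.IH) (auto simp: card_insert_if)
  also have "\<dots> = subdet U I J"
    using insert.prems by (intro subdet_insert_min[OF U]) auto
  finally show ?case by simp
qed simp

text \<open>Mirror image of the preceding induction: the smallest element of the segment is moved
  first and removed last, as a common maximum.\<close>

lemma subdet_union_above:
  assumes U: "U \<in> carrier_mat n n" "upper_unitriangular U"
    and K: "finite K" "K \<subseteq> {..<n}"
    and IJ: "I \<subseteq> {..<n}" "J \<subseteq> {..<n}" "card I = card J"
    and less: "\<forall>c\<in>K. \<forall>i\<in>I \<union> J. i < c"
  shows "subdet U (K \<union> I) (K \<union> J) = subdet U I J"
  using K IJ less
proof (induction K arbitrary: I J rule: finite_linorder_min_induct)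
  case (insert b K)
  have fin: "finite I" "finite J" using insert.prems finite_subset by blast+
  have "subdet U (K \<union> insert b I) (K \<union> insert b J) = subdet U (insert b I) (insert b J)"
    using insert.prems insert.hyps fin by (intro insert.IH) (auto simp: card_insert_if)
  also have "\<dots> = subdet U I J"
    using insert.prems by (intro subdet_insert_max[OF U]) auto
  finally show ?case by simp
qed simp

subsection \<open>The Gauss decomposition of the generic matrix\<close>

lemma mult_mat_index_sum:
  assumes "A \<in> carrier_mat n n" "B \<in> carrier_mat n n" "i < n" "j < n"
  shows "(A * B) $$ (i, j) = (\<Sum>m<n. A $$ (i, m) * B $$ (m, j))"
  using assms by (simp add: scalar_prod_def atLeast0LessThan)

lemma sum_lessThan_truncate:
  fixes f :: "nat \<Rightarrow> 'a::comm_monoid_add"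
  assumes "j < n" "\<And>m. j < m \<Longrightarrow> m < n \<Longrightarrow> f m = 0"
  shows "(\<Sum>m<n. f m) = (\<Sum>m<j. f m) + f j"
proof -
  have "(\<Sum>m<n. f m) = (\<Sum>m<Suc j. f m)"
    using assms by (intro sum.mono_neutral_right) auto
  then show ?thesis by simp
qed

text \<open>Comparing entries of the two products determines alternately column \<open>j\<close> of
  the lower factor and row \<open>j\<close> of the upper factor, since all terms with summation
  index below \<open>j\<close> agree by induction.\<close>

lemma lu_decomposition_unique:
  fixes L L' U U' :: "'a::idom mat"
  assumes L: "L \<in> carrier_mat n n" "\<And>i j. i < j \<Longrightarrow> j < n \<Longrightarrow> L $$ (i, j) = 0"
      "\<And>i. i < n \<Longrightarrow> L $$ (i, i) \<noteq> 0"
    and L': "L' \<in> carrier_mat n n" "\<And>i j. i < j \<Longrightarrow> j < n \<Longrightarrow> L' $$ (i, j) = 0"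
    and U: "U \<in> carrier_mat n n" "upper_unitriangular U"
    and U': "U' \<in> carrier_mat n n" "upper_unitriangular U'"
    and eq: "L * U = L' * U'"
  shows "U = U'"
proof -
  have U0: "U $$ (i, j) = 0" "U' $$ (i, j) = 0" if "j < i" "i < n" for i j
    using that U U' by (auto simp: upper_unitriangular_def)
  have U1: "U $$ (i, i) = 1" "U' $$ (i, i) = 1" if "i < n" for i
    using that U U' by (auto simp: upper_unitriangular_def)
  have eq': "(\<Sum>m<n. L $$ (i, m) * U $$ (m, j)) = (\<Sum>m<n. L' $$ (i, m) * U' $$ (m, j))"
    if "i < n" "j < n" for i j
    using mult_mat_index_sum[OF L(1) U(1) that] mult_mat_index_sum[OF L'(1) U'(1) that] eq by simp
  have "(\<forall>i<n. L $$ (i, j) = L' $$ (i, j)) \<and> (\<forall>k<n. U $$ (j, k) = U' $$ (j, k))" if "j < n" for j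
    using that
  proof (induction j rule: less_induct)
    case (less j)
    then have IH: "L $$ (i, m) = L' $$ (i, m)" "U $$ (m, i) = U' $$ (m, i)" if "m < j" "i < n" for m i
      using that less by auto
    \<comment> \<open>Terms beyond \<open>j\<close> vanish because the upper factors are triangular,
      and the \<open>j\<close>-th term is the entry of the lower factor because their diagonals are
      1.\<close>
    have col: "L $$ (i, j) = L' $$ (i, j)" if "i < n" for i
      using eq'[OF that less.prems] less.prems IH that
      by (simp add: sum_lessThan_truncate[of j n] U0 U1)
    have "U $$ (j, k) = U' $$ (j, k)" if "k < n" for k
    proof (cases "k \<le> j")
      case True
      then show ?thesis using U0 U1 less.prems that by (cases "k = j") auto
    next
      case False
      \<comment> \<open>Now terms beyond \<open>j\<close> vanish because the lower factors are
        triangular; the nonzero pivot can be cancelled.\<close>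
      then have "L $$ (j, j) * U $$ (j, k) = L $$ (j, j) * U' $$ (j, k)"
        using eq'[OF less.prems that] less.prems IH that
        by (simp add: sum_lessThan_truncate[of j n] L(2) L'(2) col)
      then show ?thesis using L(3) less.prems by simp
    qed
    then show ?case using col by auto
  qed
  then show ?thesis using U(1) U'(1) by (intro eq_matI) auto
qed

lemma exists_inverse_mat:
  fixes A :: "'a::field mat"
  assumes A: "A \<in> carrier_mat n n" "det A \<noteq> 0"
  shows "\<exists>B\<in>carrier_mat n n. A * B = 1\<^sub>m n \<and> B * A = 1\<^sub>m n"
proof
  let ?B = "inverse (det A) \<cdot>\<^sub>m adj_mat A"
  show "?B \<in> carrier_mat n n" using adj_mat(1)[OF A(1)] by simp
  have "A * ?B = inverse (det A) \<cdot>\<^sub>m (A * adj_mat A)"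
    using A(1) adj_mat(1)[OF A(1)] by (rule mult_smult_distrib)
  moreover have "?B * A = inverse (det A) \<cdot>\<^sub>m (adj_mat A * A)"
    using adj_mat(1)[OF A(1)] A(1) by (rule mult_smult_assoc_mat)
  ultimately show "A * ?B = 1\<^sub>m n \<and> ?B * A = 1\<^sub>m n"
    using A(2) unfolding adj_mat(2,3)[OF A(1)] by (auto intro!: eq_matI)
qed

text \<open>Induction on the size by bordering: a decomposition of the leading block extends to the
  last row and column by solving two triangular systems. The lower factor may have a zero as its
  last diagonal entry, hence only minors of order less than \<open>n\<close> occur.\<close>

lemma lu_decomposition_exists:
  fixes X :: "'a::field mat"
  assumes "X \<in> carrier_mat n n"
    and "\<And>k. k < n \<Longrightarrow> det (mat k k (\<lambda>ij. X $$ ij)) \<noteq> 0"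
  shows "\<exists>L U. L \<in> carrier_mat n n \<and> (\<forall>i j. i < j \<longrightarrow> j < n \<longrightarrow> L $$ (i, j) = 0) \<and>
    U \<in> carrier_mat n n \<and> upper_unitriangular U \<and> X = L * U"
  using assms
proof (induction n arbitrary: X)
  case 0
  then have "X = 1\<^sub>m 0 * 1\<^sub>m 0" by auto
  then show ?case
    by (intro exI[of _ "1\<^sub>m 0"] conjI) (auto simp: upper_unitriangular_def)
next
  case (Suc n)
  define A where "A = mat n n (\<lambda>ij. X $$ ij)"
  define b where "b = mat n 1 (\<lambda>(i, j). X $$ (i, n))"
  define c where "c = mat 1 n (\<lambda>(i, j). X $$ (n, j))"
  define d where "d = mat 1 1 (\<lambda>(i, j). X $$ (n, n))"
  have carr: "A \<in> carrier_mat n n" "b \<in> carrier_mat n 1" "c \<in> carrier_mat 1 n" "d \<in> carrier_mat 1 1"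
    unfolding A_def b_def c_def d_def by auto
  have X: "X = four_block_mat A b c d"
    using Suc.prems(1) unfolding A_def b_def c_def d_def
    by (intro eq_matI) (auto simp: less_Suc_eq)
  have "det (mat k k (\<lambda>ij. A $$ ij)) \<noteq> 0" if "k < n" for k
  proof -
    have "mat k k (\<lambda>ij. A $$ ij) = mat k k (\<lambda>ij. X $$ ij)"
      using that by (intro eq_matI) (auto simp: A_def)
    then show ?thesis using Suc.prems(2)[of k] that by simp
  qed
  from Suc.IH[OF carr(1) this] obtain L U where
    L: "L \<in> carrier_mat n n" "\<And>i j. i < j \<Longrightarrow> j < n \<Longrightarrow> L $$ (i, j) = 0"
    and U: "U \<in> carrier_mat n n" "upper_unitriangular U" and A: "A = L * U" by auto
  \<comment> \<open>\<open>A\<close> is the leading block of order \<open>n\<close> in a matrix of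
    size \<open>Suc n\<close>.\<close>
  have "det A \<noteq> 0" unfolding A_def using Suc.prems(2)[of n] by simp
  then have "det L \<noteq> 0" "det U \<noteq> 0" unfolding A det_mult[OF L(1) U(1)] by auto
  then obtain Li Ui where
    Li: "Li \<in> carrier_mat n n" "L * Li = 1\<^sub>m n" and Ui: "Ui \<in> carrier_mat n n" "Ui * U = 1\<^sub>m n"
    using exists_inverse_mat L(1) U(1) by meson
  \<comment> \<open>\<open>x\<close> and \<open>y\<close> are the solutions of
    \<open>L * x = b\<close> and \<open>y * U = c\<close>, as the off-diagonal blocks of the product
    require.\<close>
  define x where "x = Li * b"
  define y where "y = c * Ui"
  have xy: "x \<in> carrier_mat n 1" "y \<in> carrier_mat 1 n"
    unfolding x_def y_def using carr Li Ui by auto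
  have Lx: "L * x = b"
    unfolding x_def using L(1) Li carr by (simp add: assoc_mult_mat[symmetric, of _ n n _ n _ 1])
  have yU: "y * U = c"
    unfolding y_def using U(1) Ui carr by (simp add: assoc_mult_mat[of _ 1 n _ n _ n])
  \<comment> \<open>The corner is the Schur complement of \<open>A\<close>, since
    \<open>y * x\<close> equals \<open>c\<close> times the inverse of \<open>A\<close> times
    \<open>b\<close>.\<close>
  define L' where "L' = four_block_mat L (0\<^sub>m n 1) y (d - y * x)"
  define U' where "U' = four_block_mat U x (0\<^sub>m 1 n) (1\<^sub>m 1)"
  have "L' * U' = four_block_mat (L * U + 0\<^sub>m n 1 * 0\<^sub>m 1 n) (L * x + 0\<^sub>m n 1 * 1\<^sub>m 1)
      (y * U + (d - y * x) * 0\<^sub>m 1 n) (y * x + (d - y * x) * 1\<^sub>m 1)"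
    unfolding L'_def U'_def using L(1) U(1) xy carr by (intro mult_four_block_mat) auto
  also have "\<dots> = X"
  proof -
    have "y * x + (d - y * x) * 1\<^sub>m 1 = d"
      using xy carr by (intro eq_matI) auto
    moreover have "(d - y * x) * 0\<^sub>m 1 n = 0\<^sub>m 1 n"
      using xy carr by (intro right_mult_zero_mat) auto
    ultimately show ?thesis unfolding X A[symmetric] Lx yU using carr by simp
  qed
  finally have "X = L' * U'" by simp
  moreover have "L' \<in> carrier_mat (Suc n) (Suc n)" "U' \<in> carrier_mat (Suc n) (Suc n)"
    unfolding L'_def U'_def using L(1) U(1) xy carr
      four_block_carrier_mat[of _ n n _ 1 1] by auto
  moreover have "upper_unitriangular U'"
  proof -
    have "U' $$ (i, j) = (if i < n then if j < n then U $$ (i, j) else x $$ (i, j - n)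
        else if j < n then 0 else 1)" if "i < Suc n" "j < Suc n" for i j
      using that U xy unfolding U'_def by (auto simp: less_Suc_eq)
    moreover have "dim_row U' = Suc n" unfolding U'_def using U by simp
    moreover have "U $$ (i, j) = 0" if "j < i" "i < n" for i j
      using U that by (auto simp: upper_unitriangular_def)
    ultimately show ?thesis using U unfolding upper_unitriangular_def
      by (auto intro!: upper_triangularI)
  qed
  moreover have "\<forall>i j. i < j \<longrightarrow> j < Suc n \<longrightarrow> L' $$ (i, j) = 0"
    unfolding L'_def using L xy carr by (auto simp: less_Suc_eq)
  ultimately show ?case by blast
qed

text \<open>Splitting the diagonal off the lower factor of an LU decomposition gives existence.
  Conversely, multiplying the first two factors of any Gauss decomposition gives an LU
  decomposition, so uniqueness of the latter makes the definite description meaningful.\<close>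

lemma gauss_upper_unitriangular:
  fixes X :: "'a::field mat"
  assumes X: "X \<in> carrier_mat n n"
    and minors: "\<And>k. k \<le> n \<Longrightarrow> det (mat k k (\<lambda>ij. X $$ ij)) \<noteq> 0"
  shows "gauss_upper X \<in> carrier_mat n n \<and> upper_unitriangular (gauss_upper X)"
proof -
  have "mat n n (\<lambda>ij. X $$ ij) = X" using X by auto
  then have detX: "det X \<noteq> 0" using minors[of n] by simp
  obtain L U where
    L: "L \<in> carrier_mat n n" "\<And>i j. i < j \<Longrightarrow> j < n \<Longrightarrow> L $$ (i, j) = 0"
    and U: "U \<in> carrier_mat n n" "upper_unitriangular U" and LU: "X = L * U"
    using lu_decomposition_exists[OF X] minors by (metis less_imp_le)
  have "det L \<noteq> 0" using detX unfolding LU det_mult[OF L(1) U(1)] by auto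
  moreover have "det L = prod_list (diag_mat L)"
    using L by (intro det_lower_triangular) auto
  ultimately have diag: "L $$ (i, i) \<noteq> 0" if "i < n" for i
    using that L(1) by (auto simp: diag_mat_def prod_list_zero_iff)
  \<comment> \<open>Column \<open>j\<close> of \<open>L\<close> is divided by its pivot, which is
    nonzero because \<open>det X\<close> is.\<close>
  define Xm where "Xm = mat n n (\<lambda>(i, j). L $$ (i, j) / L $$ (j, j))"
  define X0 where "X0 = mat n n (\<lambda>(i, j). if i = j then L $$ (i, i) else 0)"
  have carr: "Xm \<in> carrier_mat n n" "X0 \<in> carrier_mat n n" unfolding Xm_def X0_def by auto
  have "(Xm * X0) $$ (i, j) = L $$ (i, j)" if "i < n" "j < n" for i j
  proof -
    have "(Xm * X0) $$ (i, j) = (\<Sum>m<n. if m = j then L $$ (i, j) else 0)"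
      unfolding mult_mat_index_sum[OF carr that] using that diag
      by (intro sum.cong) (auto simp: Xm_def X0_def)
    then show ?thesis using that by simp
  qed
  then have "Xm * X0 = L" using L(1) carr by (intro eq_matI) auto
  moreover have "upper_unitriangular (Xm\<^sup>T)"
    using L diag unfolding upper_unitriangular_def Xm_def by auto
  moreover have "diagonal_mat X0" unfolding diagonal_mat_def X0_def by auto
  ultimately have ex: "gauss_decomposition X Xm X0 U"
    using X U LU carr unfolding gauss_decomposition_def by auto
  have "Up = U" if "gauss_decomposition X Ym Y0 Up" for Ym Y0 Up
  proof -
    from that X have Y: "Ym \<in> carrier_mat n n" "Y0 \<in> carrier_mat n n" "Up \<in> carrier_mat n n"
      "upper_unitriangular (Ym\<^sup>T)" "diagonal_mat Y0" "upper_unitriangular Up" "X = Ym * Y0 * Up"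
      unfolding gauss_decomposition_def by (auto simp: Let_def)
    \<comment> \<open>A diagonal right factor only scales columns, so the product stays lower
      triangular.\<close>
    have "(Ym * Y0) $$ (i, j) = 0" if "i < j" "j < n" for i j
    proof -
      have "Ym $$ (i, m) * Y0 $$ (m, j) = 0" if "m < n" for m
      proof (cases "m = j")
        case True
        then have "Ym\<^sup>T $$ (j, i) = 0"
          using Y(1,4) \<open>i < j\<close> \<open>j < n\<close> unfolding upper_unitriangular_def
          by (intro upper_triangularD[of "Ym\<^sup>T" i j]) auto
        then show ?thesis using True Y(1) \<open>i < j\<close> \<open>j < n\<close> by simp
      next
        case False
        then show ?thesis using Y(2,5) that \<open>j < n\<close> unfolding diagonal_mat_def by auto
      qed
      then have "(\<Sum>m<n. Ym $$ (i, m) * Y0 $$ (m, j)) = 0" by (intro sum.neutral) auto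
      then show ?thesis using that mult_mat_index_sum[OF Y(1,2), of i j] by simp
    qed
    then show ?thesis
      using lu_decomposition_unique[OF L diag _ _ U Y(3,6), of "Ym * Y0"] Y LU by auto
  qed
  then have "gauss_upper X = U"
    unfolding gauss_upper_def using ex by (intro the_equality) blast+
  then show ?thesis using U by simp
qed

section \<open>Leading minors of the generic matrix\<close>

lemma Fract_1_hom: "comm_ring_hom (\<lambda>x::'a::idom. Fract x 1)"
  by unfold_locales (auto simp: One_fract_def Zero_fract_def)

lemma prod_single_1:
  "finite A \<Longrightarrow> (\<Prod>i\<in>A. Poly_Mapping.single (m i) (1::'a::comm_semiring_1)) =
    Poly_Mapping.single (\<Sum>i\<in>A. m i) 1"
  by (induction A rule: finite_induct) (auto simp: mult_single)

text \<open>The product of the diagonal indeterminates arises in the Leibniz expansion from the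
  identity permutation alone, so its coefficient in the determinant is 1.\<close>

lemma det_indeterminates_nonzero:
  "det (mat k k (\<lambda>(i, j). Poly_Mapping.single (Poly_Mapping.single (i + 1, j + 1) 1) 1 ::
      (nat \<times> nat \<Rightarrow>\<^sub>0 nat) \<Rightarrow>\<^sub>0 complex)) \<noteq> 0" (is "det ?M \<noteq> 0")
proof -
  \<comment> \<open>The exponent of the monomial contributed by \<open>p\<close>. The diagonal
    exponents computed next record which indices \<open>p\<close> fixes, so
    \<open>m p = m id\<close> forces \<open>p = id\<close>.\<close>
  define m :: "(nat \<Rightarrow> nat) \<Rightarrow> (nat \<times> nat \<Rightarrow>\<^sub>0 nat)"
    where "m p = (\<Sum>i<k. Poly_Mapping.single (i + 1, p i + 1) 1)" for p
  have lookup_m: "Poly_Mapping.lookup (m p) (i + 1, i + 1) = (if p i = i then 1 else (0::nat))" if "i < k" for p i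
  proof -
    have "Poly_Mapping.lookup (m p) (i + 1, i + 1) = (\<Sum>a<k. if a = i then if p i = i then 1 else 0 else 0)"
      unfolding m_def Poly_Mapping.lookup_sum
      by (intro sum.cong refl) (auto simp: lookup_single when_def)
    then show ?thesis using that by simp
  qed
  have "det ?M = (\<Sum>p | p permutes {0..<k}. signof p * Poly_Mapping.single (m p) 1)"
  proof (subst det_def'[of _ k], goal_cases)
    case 2
    show ?case
    proof (intro sum.cong refl arg_cong2[of _ _ _ _ "(*)"])
      fix p assume "p \<in> {p. p permutes {0..<k}}"
      then have "(\<Prod>i=0..<k. ?M $$ (i, p i)) =
          (\<Prod>i\<in>{0..<k}. Poly_Mapping.single (Poly_Mapping.single (i + 1, p i + 1) 1) 1)"
        by (intro prod.cong refl) (auto simp: permutes_in_image[of p "{0..<k}", simplified])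
      then show "(\<Prod>i=0..<k. ?M $$ (i, p i)) = Poly_Mapping.single (m p) 1"
        by (simp add: prod_single_1 m_def atLeast0LessThan)
    qed
  qed auto
  then have "Poly_Mapping.lookup (det ?M) (m id) =
      (\<Sum>p | p permutes {0..<k}. Poly_Mapping.lookup (signof p * Poly_Mapping.single (m p) 1) (m id))"
    by (simp add: Poly_Mapping.lookup_sum)
  also have "\<dots> = (\<Sum>p | p permutes {0..<k}. if p = id then 1 else 0)"
  proof (intro sum.cong refl)
    fix p assume "p \<in> {p. p permutes {0..<k}}"
    then have p: "p permutes {0..<k}" by simp
    have "m p \<noteq> m id" if "p \<noteq> id"
    proof
      assume "m p = m id"
      then have eq: "(if p i = i then 1 else (0::nat)) = 1" if "i < k" for i
        using lookup_m[OF that, of p] lookup_m[OF that, of id] by simp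
      have "p = id"
      proof
        fix i show "p i = id i"
          using eq[of i] permutes_not_in[OF p, of i] by (cases "i < k") (auto split: if_splits)
      qed
      then show False using that by simp
    qed
    then have ne: "p \<noteq> id \<Longrightarrow> Poly_Mapping.lookup (Poly_Mapping.single (m p) (1::complex)) (m id) = 0"
      by (simp add: lookup_single when_def)
    have "Poly_Mapping.lookup (signof p * Poly_Mapping.single (m p) (1::complex)) (m id) =
        signof p * Poly_Mapping.lookup (Poly_Mapping.single (m p) 1) (m id)"
      by (cases "evenperm p") (simp_all add: sign_def)
    then show "Poly_Mapping.lookup (signof p * Poly_Mapping.single (m p) (1::complex)) (m id) = (if p = id then 1 else 0)"
      using ne by (cases "p = id") simp_all
  qed
  also have "\<dots> = 1" by (simp add: finite_permutations permutes_id)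
  finally show ?thesis by auto
qed

lemma generic_leading_minor_nonzero:
  assumes "k \<le> N"
  shows "det (mat k k (\<lambda>ij. generic_mat N $$ ij)) \<noteq> 0"
proof -
  let ?M = "mat k k (\<lambda>(i, j). Poly_Mapping.single (Poly_Mapping.single (i + 1, j + 1) 1) 1 ::
      (nat \<times> nat \<Rightarrow>\<^sub>0 nat) \<Rightarrow>\<^sub>0 complex)"
  have "mat k k (\<lambda>ij. generic_mat N $$ ij) = map_mat (\<lambda>x. Fract x 1) ?M"
    using assms by (intro eq_matI) (auto simp: generic_mat_def indet_def)
  then have "det (mat k k (\<lambda>ij. generic_mat N $$ ij)) = Fract (det ?M) 1"
    using comm_ring_hom.hom_det[OF Fract_1_hom] by metis
  then show ?thesis
    using det_indeterminates_nonzero[of k] by (simp add: Zero_fract_def eq_fract)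
qed

lemma gauss_upper_generic_mat:
  "gauss_upper (generic_mat N) \<in> carrier_mat N N"
  "upper_unitriangular (gauss_upper (generic_mat N))"
  using gauss_upper_unitriangular[of "generic_mat N" N] generic_leading_minor_nonzero
  by (auto simp: generic_mat_def)

subsection \<open>Index sets of partitions and minors\<close>

declare One_nat_def [simp del]

lemma minor_eq_subdet: "minor A I J = subdet A ((\<lambda>i. i - 1) ` I) ((\<lambda>j. j - 1) ` J)"
  by (simp add: minor_def subdet_def)

text \<open>Reversing the order by \<open>i = r + 1 - a\<close> and counting from 0 gives the beta
  numbers \<open>\<nu>_i + r - i\<close>, the form in which all index sets are handled
  below.\<close>

lemma index_set_pred:
  "(\<lambda>i. i - 1) ` index_set r \<nu> = (\<lambda>i. nat (part \<nu> i + int r - int i)) ` {1..r}"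
proof -
  have "(\<lambda>a. r + 1 - a) ` {1..r} = {1..r}"
  proof (intro equalityI subsetI)
    fix x assume "x \<in> {1..r}"
    then have "x = r + 1 - (r + 1 - x)" "r + 1 - x \<in> {1..r}" by auto
    then show "x \<in> (\<lambda>a. r + 1 - a) ` {1..r}" by (rule image_eqI)
  qed auto
  then have "(\<lambda>i. nat (part \<nu> i + int r - int i)) ` {1..r} =
      (\<lambda>i. nat (part \<nu> i + int r - int i)) ` (\<lambda>a. r + 1 - a) ` {1..r}" by simp
  also have "\<dots> = (\<lambda>i. i - 1) ` index_set r \<nu>"
    unfolding index_set_def image_image by (intro image_cong refl) (auto simp: of_nat_diff)
  finally show ?thesis by simp
qed

lemma part_seq: "part (seq f 1 m) i = (if 1 \<le> i \<and> i \<le> m then f i else 0)"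
  by (auto simp: part_def seq_def simp del: upt_Suc)

lemma seq_Suc: "seq f (Suc a) (Suc b) = seq (\<lambda>i. f (Suc i)) a b"
  unfolding seq_def by (simp add: map_Suc_upt[symmetric] comp_def del: upt_Suc)

lemma is_partition_seq:
  "is_partition (seq f 1 m) \<longleftrightarrow> (\<forall>i j. 1 \<le> i \<longrightarrow> i < j \<longrightarrow> j \<le> m \<longrightarrow> f j \<le> f i) \<and> (\<forall>i\<in>{1..m}. 0 \<le> f i)"
proof -
  have "sorted_wrt (\<ge>) (seq f 1 m) \<longleftrightarrow> (\<forall>i j. 1 \<le> i \<longrightarrow> i < j \<longrightarrow> j \<le> m \<longrightarrow> f j \<le> f i)"
    (is "?S \<longleftrightarrow> ?R")
  proof
    assume ?S
    then have *: "f (Suc j) \<le> f (Suc i)" if "i < j" "j < m" for i j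
      using that unfolding sorted_wrt_iff_nth_less by (auto simp: seq_def One_nat_def simp del: upt_Suc)
    show ?R
    proof (intro allI impI)
      fix i j assume "1 \<le> i" "i < j" "j \<le> m"
      then show "f j \<le> f i" using *[of "i - 1" "j - 1"] by simp
    qed
  next
    assume ?R
    then show ?S
      unfolding sorted_wrt_iff_nth_less by (auto simp: seq_def simp del: upt_Suc)
  qed
  moreover have "set (seq f 1 m) = f ` {1..m}"
    unfolding seq_def by (simp add: atLeastLessThanSuc_atLeastAtMost One_nat_def del: upt_Suc)
  ultimately show ?thesis unfolding is_partition_def by auto
qed

section \<open>Partitions and their conjugates\<close>

lemma part_antimono:
  assumes "is_partition \<nu>" "1 \<le> i" "i \<le> j"
  shows "part \<nu> j \<le> part \<nu> i"
  using assms unfolding is_partition_def sorted_wrt_iff_nth_less part_def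
  by (cases "i = j") auto

lemma part_nonneg: "is_partition \<nu> \<Longrightarrow> 0 \<le> part \<nu> i"
  unfolding is_partition_def part_def by auto

lemma finite_parts_ge: "1 \<le> j \<Longrightarrow> finite {i. 1 \<le> i \<and> int j \<le> part \<nu> i}"
  by (rule finite_subset[of _ "{..length \<nu>}"]) (auto simp: part_def split: if_splits)

lemma conj_seq_partition:
  "is_partition \<nu> \<Longrightarrow>
    conj_seq \<nu> = seq (\<lambda>j. int (card {i. 1 \<le> i \<and> int j \<le> part \<nu> i})) 1 (nat (part \<nu> 1))"
  by (simp add: conj_seq_def seq_def)

text \<open>Inside the list this is its definition; beyond its length, the first part of
  \<open>\<nu>\<close>, no part is as large as \<open>j\<close> and both sides are 0.\<close>

lemma part_conj_seq:
  assumes "is_partition \<nu>" "1 \<le> j"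
  shows "part (conj_seq \<nu>) j = int (card {i. 1 \<le> i \<and> int j \<le> part \<nu> i})"
proof (cases "int j \<le> part \<nu> 1")
  case True
  then have "j \<le> nat (part \<nu> 1)" by linarith
  then show ?thesis using assms(2) unfolding conj_seq_partition[OF assms(1)] part_seq by simp
next
  case False
  then have "{i. 1 \<le> i \<and> int j \<le> part \<nu> i} = {}"
    using part_antimono[OF assms(1), of 1] by fastforce
  then have "card {i. 1 \<le> i \<and> int j \<le> part \<nu> i} = 0" by (simp only: card.empty)
  moreover have "\<not> j \<le> nat (part \<nu> 1)" using False assms(2) by linarith
  ultimately show ?thesis unfolding conj_seq_partition[OF assms(1)] part_seq by simp
qed

lemma is_partition_conj_seq:
  assumes "is_partition \<nu>"
  shows "is_partition (conj_seq \<nu>)"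
proof -
  have "int (card {a. 1 \<le> a \<and> int j \<le> part \<nu> a}) \<le> int (card {a. 1 \<le> a \<and> int i \<le> part \<nu> a})"
    if "1 \<le> i" "i < j" for i j
    using that finite_parts_ge[of i \<nu>] by (auto intro!: card_mono)
  then show ?thesis unfolding conj_seq_partition[OF assms] is_partition_seq by simp
qed

lemma is_skew_conj_seq:
  assumes "is_skew \<nu> \<mu>"
  shows "is_skew (conj_seq \<nu>) (conj_seq \<mu>)"
proof -
  have p: "is_partition \<nu>" "is_partition \<mu>" and c: "\<And>i. 1 \<le> i \<Longrightarrow> part \<mu> i \<le> part \<nu> i"
    using assms by (auto simp: is_skew_def contained_def)
  have "contained (conj_seq \<mu>) (conj_seq \<nu>)"
    unfolding contained_def
  proof (intro allI impI)
    fix j :: nat assume j: "1 \<le> j"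
    have "{i. 1 \<le> i \<and> int j \<le> part \<mu> i} \<subseteq> {i. 1 \<le> i \<and> int j \<le> part \<nu> i}"
      using c order_trans by blast
    then show "part (conj_seq \<mu>) j \<le> part (conj_seq \<nu>) j"
      unfolding part_conj_seq[OF p(1) j] part_conj_seq[OF p(2) j]
      by (intro of_nat_mono card_mono finite_parts_ge j)
  qed
  then show ?thesis using p is_partition_conj_seq by (simp add: is_skew_def)
qed

lemma antimono_index_less:
  assumes anti: "\<forall>i j. 1 \<le> i \<longrightarrow> i < j \<longrightarrow> j \<le> m \<longrightarrow> f j \<le> (f i :: int)"
    and nonneg: "\<forall>i\<in>{1..m}. 0 \<le> f i + int r - int i"
    and "1 \<le> i" "i < j" "j \<le> m"
  shows "nat (f j + int r - int j) < nat (f i + int r - int i)"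
  using assms(1)[rule_format, OF assms(3-5)] assms(2)[rule_format, of j] assms(3-5) by auto

section \<open>Skew minors in terms of the parts\<close>

lemma S_rows:
  fixes f g :: "nat \<Rightarrow> int"
  assumes U: "gauss_upper X = U" "U \<in> carrier_mat N N" "upper_unitriangular U"
    and f: "\<forall>i j. 1 \<le> i \<longrightarrow> i < j \<longrightarrow> j \<le> m \<longrightarrow> f j \<le> f i"
      "\<forall>i\<in>{1..m}. 0 \<le> f i + int r - int i \<and> f i + int r \<le> int N"
    and g: "\<forall>i j. 1 \<le> i \<longrightarrow> i < j \<longrightarrow> j \<le> m \<longrightarrow> g j \<le> g i"
      "\<forall>i\<in>{1..m}. 0 \<le> g i \<and> g i + int r \<le> int N"
    and m: "m \<le> r" "r \<le> N"
  shows "S X r (seq f 1 m) (seq g 1 m) =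
    subdet U ((\<lambda>i. nat (g i + int r - int i)) ` {1..m}) ((\<lambda>i. nat (f i + int r - int i)) ` {1..m})"
proof -
  let ?F = "\<lambda>i. nat (f i + int r - int i)" and ?G = "\<lambda>i. nat (g i + int r - int i)"
  have ut: "upper_triangular U" using U(3) by (simp add: upper_unitriangular_def)
  have gr: "\<forall>i\<in>{1..m}. 0 \<le> g i + int r - int i" using g(2) m by fastforce
  have less: "?F j < ?F i" "?G j < ?G i" if "1 \<le> i" "i < j" "j \<le> m" for i j
    using antimono_index_less[OF f(1) _ that] antimono_index_less[OF g(1) gr that] f(2) by auto
  have inj: "inj_on ?F {1..m}" "inj_on ?G {1..m}"
    by (rule linorder_inj_onI', metis less atLeastAtMost_iff less_irrefl)+
  then have card: "card (?F ` {1..m}) = m" "card (?G ` {1..m}) = m" by (auto simp: card_image)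
  have sub: "?F ` {1..m} \<subseteq> {..<N}" "?G ` {1..m} \<subseteq> {..<N}"
    using f(2) g(2) by fastforce+
  show ?thesis
  proof (cases "\<exists>i\<in>{1..m}. f i < g i")
    case True
    then obtain i where i: "i \<in> {1..m}" "f i < g i" by auto
    have "\<not> contained (seq g 1 m) (seq f 1 m)"
      unfolding contained_def part_seq using i by auto
    then have "S X r (seq f 1 m) (seq g 1 m) = 0" by (simp add: S_def is_skew_def)
    moreover have "subdet U (?G ` {1..m}) (?F ` {1..m}) = 0"
    proof (rule subdet_upper_triangular_eq_0[OF U(2) _ sub(2,1), of "?G i"])
      have lt: "?F i < ?G i" using i f(2)[rule_format, OF i(1)] by linarith
      \<comment> \<open>The indices are strictly decreasing, so at most \<open>i - 1\<close> columns
        reach \<open>?G i\<close>, whereas the first \<open>i\<close> rows do; this is the zero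
        block.\<close>
      have "{j \<in> ?F ` {1..m}. ?G i \<le> j} \<subseteq> ?F ` {1..<i}"
      proof
        fix x assume "x \<in> {j \<in> ?F ` {1..m}. ?G i \<le> j}"
        then obtain j where j: "j \<in> {1..m}" "x = ?F j" "?G i \<le> ?F j" by auto
        have "j < i"
        proof (rule ccontr)
          assume "\<not> j < i"
          then have "?F j \<le> ?F i" using less(1)[of i j] i j by (cases "i = j") auto
          then show False using lt j by simp
        qed
        then show "x \<in> ?F ` {1..<i}" using j by auto
      qed
      then have "card {j \<in> ?F ` {1..m}. ?G i \<le> j} \<le> card (?F ` {1..<i})"
        by (intro card_mono) auto
      also have "\<dots> \<le> card {1..<i}" by (rule card_image_le) simp
      also have "\<dots> < card {1..i}" using i by simp
      also have "\<dots> = card (?G ` {1..i})"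
        using inj_on_subset[OF inj(2), of "{1..i}"] i by (simp add: card_image)
      also have "\<dots> \<le> card {j \<in> ?G ` {1..m}. ?G i \<le> j}"
      proof (intro card_mono subsetI)
        fix x assume "x \<in> ?G ` {1..i}"
        then obtain j where j: "1 \<le> j" "j \<le> i" "x = ?G j" by auto
        then show "x \<in> {j \<in> ?G ` {1..m}. ?G i \<le> j}"
          using less(2)[of j i] i by (cases "j = i") auto
      qed simp
      finally show "card {j \<in> ?F ` {1..m}. ?G i \<le> j} < card {j \<in> ?G ` {1..m}. ?G i \<le> j}" .
    qed (simp_all only: ut card)
    ultimately show ?thesis by (simp only:)
  next
    case False
    have fg: "0 \<le> g i \<and> g i \<le> f i" if "i \<in> {1..m}" for i
    proof -
      have "\<not> f i < g i" using False that by blast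
      then show ?thesis using g(2)[rule_format, OF that] by simp
    qed
    have f0: "0 \<le> f i" if "i \<in> {1..m}" for i using fg[OF that] by simp
    have "is_partition (seq f 1 m)" "is_partition (seq g 1 m)"
      unfolding is_partition_seq using f(1) g(1) f0 fg by blast+
    then have "is_skew (seq f 1 m) (seq g 1 m)"
      using fg by (simp add: is_skew_def contained_def part_seq)
    then have "S X r (seq f 1 m) (seq g 1 m) =
        subdet U ((\<lambda>i. nat (part (seq g 1 m) i + int r - int i)) ` {1..r})
          ((\<lambda>i. nat (part (seq f 1 m) i + int r - int i)) ` {1..r})"
      unfolding S_def minor_eq_subdet index_set_pred U(1) by (simp only: if_True)
    \<comment> \<open>The zero parts have positions \<open>m + 1\<close> to \<open>r\<close> and
      indices \<open>r - i\<close>, which fill \<open>{..<r - m}\<close>.\<close>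
    moreover have "(\<lambda>i. nat (part (seq h 1 m) i + int r - int i)) ` {1..r} =
        {..<r - m} \<union> (\<lambda>i. nat (h i + int r - int i)) ` {1..m}" for h
    proof -
      have "(\<lambda>i. nat (part (seq h 1 m) i + int r - int i)) ` {m+1..r} = (\<lambda>i. r - i) ` {m+1..r}"
        by (intro image_cong refl) (auto simp: part_seq)
      also have "\<dots> = {..<r - m}"
      proof (intro equalityI subsetI)
        fix x assume "x \<in> {..<r - m}"
        then have "x = r - (r - x)" "r - x \<in> {m+1..r}" by auto
        then show "x \<in> (\<lambda>i. r - i) ` {m+1..r}" by (rule image_eqI)
      qed auto
      moreover have "(\<lambda>i. nat (part (seq h 1 m) i + int r - int i)) ` {1..m} =
          (\<lambda>i. nat (h i + int r - int i)) ` {1..m}"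
        by (intro image_cong refl) (auto simp: part_seq)
      moreover have "{1..r} = {m+1..r} \<union> {1..m}" using m by auto
      ultimately show ?thesis by (simp only: image_Un)
    qed
    moreover have "subdet U ({..<r - m} \<union> ?G ` {1..m}) ({..<r - m} \<union> ?F ` {1..m}) =
        subdet U (?G ` {1..m}) (?F ` {1..m})"
    proof (rule subdet_union_below[OF U(2,3) _ _ sub(2,1)])
      show "\<forall>c\<in>{..<r - m}. \<forall>i\<in>?G ` {1..m} \<union> ?F ` {1..m}. c < i"
        using fg f0 m by fastforce
    qed (use m card in auto)
    ultimately show ?thesis by simp
  qed
qed

section \<open>Skew minors in terms of the conjugate parts\<close>

text \<open>By monotonicity the positions of the parts of size at least \<open>i\<close> form an
  initial segment, so its cardinality is at least \<open>j\<close> exactly when \<open>j\<close>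
  belongs to it.\<close>

lemma le_part_conj_seq_iff:
  assumes "is_partition \<nu>" "1 \<le> i" "1 \<le> j"
  shows "int j \<le> part (conj_seq \<nu>) i \<longleftrightarrow> int i \<le> part \<nu> j"
proof -
  let ?A = "{a. 1 \<le> a \<and> int i \<le> part \<nu> a}"
  have "j \<le> card ?A \<longleftrightarrow> int i \<le> part \<nu> j"
  proof
    assume "int i \<le> part \<nu> j"
    then have "{1..j} \<subseteq> ?A" using part_antimono[OF assms(1)] order_trans by fastforce
    from card_mono[OF finite_parts_ge[OF assms(2)] this] show "j \<le> card ?A" by simp
  next
    assume *: "j \<le> card ?A"
    show "int i \<le> part \<nu> j"
    proof (rule ccontr)
      assume "\<not> int i \<le> part \<nu> j"
      then have "a < j" if "1 \<le> a" "int i \<le> part \<nu> a" for a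
        using part_antimono[OF assms(1,3), of a] that by fastforce
      then have "?A \<subseteq> {1..<j}" by auto
      then have "card ?A \<le> card {1..<j}" by (rule card_mono[rotated]) simp
      then show False using * assms(3) by simp
    qed
  qed
  then show ?thesis by (simp add: part_conj_seq assms)
qed

text \<open>The classical complementarity of the beta numbers of conjugate partitions: the two
  families are disjoint, and their sizes \<open>r\<close> and \<open>m\<close> add up to that of the
  interval.\<close>

lemma index_set_conj_seq:
  assumes F: "is_partition (seq f 1 m)" and r: "\<forall>i\<in>{1..m}. f i \<le> int r"
  shows "(\<lambda>i. nat (part (conj_seq (seq f 1 m)) i + int r - int i)) ` {1..r} =
    {..<r + m} - (\<lambda>j. nat (int r + int j - 1 - f j)) ` {1..m}" (is "?G ` _ = _ - ?H ` _")
proof -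
  let ?c = "part (conj_seq (seq f 1 m))"
  have f: "\<And>i j. 1 \<le> i \<Longrightarrow> i < j \<Longrightarrow> j \<le> m \<Longrightarrow> f j \<le> f i" "\<And>i. i \<in> {1..m} \<Longrightarrow> 0 \<le> f i"
    using F unfolding is_partition_seq by auto
  have c0: "0 \<le> ?c i" for i using part_nonneg[OF is_partition_conj_seq[OF F]] .
  have c_anti: "?c j \<le> ?c i" if "1 \<le> i" "i < j" for i j
    using part_antimono[OF is_partition_conj_seq[OF F]] that by simp
  have iff: "int j \<le> ?c i \<longleftrightarrow> int i \<le> f j" if "1 \<le> i" "j \<in> {1..m}" for i j
    using le_part_conj_seq_iff[OF F that(1), of j] that by (simp add: part_seq)
  have cm: "?c i \<le> int m" if "1 \<le> i" for i
  proof -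
    have "\<not> int (Suc m) \<le> ?c i"
      using le_part_conj_seq_iff[OF F that, of "Suc m"] that by (simp add: part_seq)
    then show ?thesis by simp
  qed
  have "?G ` {1..r} \<subseteq> {..<r + m} - ?H ` {1..m}"
  proof (intro subsetI)
    fix x assume "x \<in> ?G ` {1..r}"
    then obtain i where i: "1 \<le> i" "i \<le> r" and xi: "x = ?G i" by auto
    have x: "int x = ?c i + int r - int i" using c0[of i] i unfolding xi by simp
    have "x < r + m" using cm[OF i(1)] i x by linarith
    moreover have "x \<noteq> ?H j" if j: "j \<in> {1..m}" for j
    proof -
      \<comment> \<open>Equality of the two numbers would mean
        \<open>?c i + f j = i + j - 1\<close>, but this sum is at least \<open>i + j\<close> in the
        first case and at most \<open>i + j - 2\<close> in the second.\<close>
      have "int j \<le> ?c i \<and> int i \<le> f j \<or> ?c i < int j \<and> f j < int i"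
        using iff[OF i(1) j] by linarith
      moreover have "int (?H j) = int r + int j - 1 - f j"
        using r[rule_format, OF j] j by simp
      ultimately show ?thesis using x by linarith
    qed
    ultimately show "x \<in> {..<r + m} - ?H ` {1..m}" by blast
  qed
  moreover have "inj_on ?G {1..r}"
  proof (rule linorder_inj_onI')
    fix i j assume "i \<in> {1..r}" "j \<in> {1..r}" "i < j"
    then show "?G i \<noteq> ?G j" using c_anti[of i j] c0[of j] by auto
  qed
  moreover have "card ({..<r + m} - ?H ` {1..m}) = r"
  proof -
    have "inj_on ?H {1..m}"
    proof (rule linorder_inj_onI')
      fix i j assume "i \<in> {1..m}" "j \<in> {1..m}" "i < j"
      then show "?H i \<noteq> ?H j" using f(1)[of i j] r[rule_format, of i] by auto
    qed
    moreover have "?H ` {1..m} \<subseteq> {..<r + m}"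
      using r f(2) by fastforce
    ultimately show ?thesis by (simp add: card_Diff_subset card_image)
  qed
  ultimately show ?thesis by (intro card_subset_eq) (auto simp: card_image)
qed

text \<open>The bound \<open>n\<close> is a common frame in which minors with different
  \<open>r\<close> and \<open>m\<close> can be compared: enlarging \<open>{..<r + m}\<close> to
  \<open>{..<n}\<close> adds the same final segment to both index sets. Again \<open>f\<close> may
  fail to be a partition or to contain \<open>g\<close>, and then both sides vanish.\<close>

lemma S_columns:
  fixes f g :: "nat \<Rightarrow> int"
  assumes U: "gauss_upper X = U" "U \<in> carrier_mat N N" "upper_unitriangular U"
    and f: "\<forall>i j. 1 \<le> i \<longrightarrow> i < j \<longrightarrow> j \<le> m \<longrightarrow> f j \<le> f i"
      "\<forall>i\<in>{1..m}. f i \<le> int r \<and> int r + int i - 1 - f i < int n"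
    and g: "\<forall>i j. 1 \<le> i \<longrightarrow> i < j \<longrightarrow> j \<le> m \<longrightarrow> g j \<le> g i"
      "\<forall>i\<in>{1..m}. 0 \<le> g i \<and> g i \<le> int r"
    and n: "r + m \<le> n" "n \<le> N"
  shows "S X r (conj_seq (seq f 1 m)) (conj_seq (seq g 1 m)) =
    subdet U ({..<n} - (\<lambda>i. nat (int r + int i - 1 - g i)) ` {1..m})
      ({..<n} - (\<lambda>i. nat (int r + int i - 1 - f i)) ` {1..m})"
proof -
  let ?F = "\<lambda>i. nat (int r + int i - 1 - f i)" and ?G = "\<lambda>i. nat (int r + int i - 1 - g i)"
  let ?J = "{..<n} - ?F ` {1..m}" and ?I = "{..<n} - ?G ` {1..m}"
  have ut: "upper_triangular U" using U(3) by (simp add: upper_unitriangular_def)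
  have less: "?F i < ?F j" "?G i < ?G j" if "1 \<le> i" "i < j" "j \<le> m" for i j
    using f(1)[rule_format, OF that] g(1)[rule_format, OF that]
      f(2)[rule_format, of i] g(2)[rule_format, of i] that by auto
  have inj: "inj_on ?F {1..m}" "inj_on ?G {1..m}"
    by (rule linorder_inj_onI', metis less atLeastAtMost_iff less_irrefl)+
  have sub: "?F ` {1..m} \<subseteq> {..<n}" "?G ` {1..m} \<subseteq> {..<n}"
    using f(2) g(2) n by fastforce+
  have card: "card ?I = card ?J"
    using sub inj by (simp add: card_Diff_subset card_image)
  have IJN: "?I \<subseteq> {..<N}" "?J \<subseteq> {..<N}" using n by auto
  \<comment> \<open>From \<open>?F i\<close> on, the deleted columns include those of
    \<open>i\<close> to \<open>m\<close>, while the deleted rows come only from \<open>i + 1\<close>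
    to \<open>m\<close>. Hence fewer columns than rows remain there.\<close>
  have zero: "subdet U ?I ?J = 0" if i: "i \<in> {1..m}" "f i < g i" for i
  proof (rule subdet_upper_triangular_eq_0[OF U(2) _ IJN card, of "?F i"])
    have lt: "?G i < ?F i" using i f(2)[rule_format, OF i(1)] g(2)[rule_format, OF i(1)] by auto
    let ?T = "{x. x < n \<and> ?F i \<le> x}"
    have "{x \<in> ?G ` {1..m}. ?F i \<le> x} \<subseteq> ?G ` {i<..m}"
    proof
      fix x assume "x \<in> {x \<in> ?G ` {1..m}. ?F i \<le> x}"
      then obtain j where j: "j \<in> {1..m}" "x = ?G j" "?F i \<le> ?G j" by auto
      have "i < j"
      proof (rule ccontr)
        assume "\<not> i < j"
        then have "?G j \<le> ?G i" using less(2)[of j i] i j by (cases "i = j") auto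
        then show False using lt j by simp
      qed
      then show "x \<in> ?G ` {i<..m}" using j by auto
    qed
    then have "card {x \<in> ?G ` {1..m}. ?F i \<le> x} \<le> card (?G ` {i<..m})"
      by (intro card_mono) auto
    also have "\<dots> \<le> card {i<..m}" by (rule card_image_le) simp
    also have "\<dots> < card {i..m}" using i by (simp add: Suc_diff_le)
    also have "\<dots> = card (?F ` {i..m})"
      using inj_on_subset[OF inj(1), of "{i..m}"] i by (simp add: card_image)
    also have "\<dots> \<le> card {x \<in> ?F ` {1..m}. ?F i \<le> x}"
    proof (intro card_mono subsetI)
      fix x assume "x \<in> ?F ` {i..m}"
      then obtain j where j: "i \<le> j" "j \<le> m" "x = ?F j" by auto
      then show "x \<in> {x \<in> ?F ` {1..m}. ?F i \<le> x}"
        using less(1)[of i j] i by (cases "j = i") auto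
    qed simp
    finally have "card {x \<in> ?G ` {1..m}. ?F i \<le> x} < card {x \<in> ?F ` {1..m}. ?F i \<le> x}" .
    moreover have "card {x \<in> ?F ` {1..m}. ?F i \<le> x} \<le> card ?T"
      using sub by (intro card_mono) auto
    moreover have "{x \<in> ?J. ?F i \<le> x} = ?T - {x \<in> ?F ` {1..m}. ?F i \<le> x}" by auto
    then have "card {x \<in> ?J. ?F i \<le> x} = card ?T - card {x \<in> ?F ` {1..m}. ?F i \<le> x}"
      using sub by (simp only:) (rule card_Diff_subset, auto)
    moreover have "{x \<in> ?I. ?F i \<le> x} = ?T - {x \<in> ?G ` {1..m}. ?F i \<le> x}" by auto
    then have "card {x \<in> ?I. ?F i \<le> x} = card ?T - card {x \<in> ?G ` {1..m}. ?F i \<le> x}"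
      using sub by (simp only:) (rule card_Diff_subset, auto)
    ultimately show "card {x \<in> ?J. ?F i \<le> x} < card {x \<in> ?I. ?F i \<le> x}" by linarith
  qed (rule ut)
  have gp: "is_partition (seq g 1 m)"
    using g unfolding is_partition_seq by blast
  show ?thesis
  proof (cases "is_partition (seq f 1 m)")
    case False
    \<comment> \<open>Since \<open>f\<close> is decreasing, only a negative entry can be at fault.
      \<open>conj_seq\<close> then returns the sequence unchanged, so \<open>S\<close> is 0 by
      convention.\<close>
    then obtain i where i: "i \<in> {1..m}" "f i < 0"
      using f(1) unfolding is_partition_seq by force
    then have "f i < g i" using g(2) by fastforce
    then show ?thesis using False zero[OF i(1)] by (simp add: S_def is_skew_def conj_seq_def)
  next
    case fp: True
    then have f0: "0 \<le> f i" if "i \<in> {1..m}" for i using that unfolding is_partition_seq by blast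
    have split: "{..<n} - H ` {1..m} = {r + m..<n} \<union> ({..<r + m} - H ` {1..m})"
      if "H ` {1..m} \<subseteq> {..<r + m}" for H :: "nat \<Rightarrow> nat"
      using that n by fastforce
    have sub': "?F ` {1..m} \<subseteq> {..<r + m}" "?G ` {1..m} \<subseteq> {..<r + m}"
      using f0 g(2) by fastforce+
    have "subdet U ?I ?J = subdet U ({..<r + m} - ?G ` {1..m}) ({..<r + m} - ?F ` {1..m})"
      unfolding split[OF sub'(1)] split[OF sub'(2)]
      using sub' inj n by (intro subdet_union_above[OF U(2,3)])
        (auto simp: card_Diff_subset card_image)
    also have "\<dots> = minor U (index_set r (conj_seq (seq g 1 m))) (index_set r (conj_seq (seq f 1 m)))"
      unfolding minor_eq_subdet index_set_pred
      using index_set_conj_seq[OF fp, of r] index_set_conj_seq[OF gp, of r] f(2) g(2) by simp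
    finally have eq: "minor U (index_set r (conj_seq (seq g 1 m))) (index_set r (conj_seq (seq f 1 m)))
      = subdet U ?I ?J" by simp
    show ?thesis
    proof (cases "is_skew (conj_seq (seq f 1 m)) (conj_seq (seq g 1 m))")
      case True
      then show ?thesis using eq U(1) by (simp add: S_def)
    next
      case False
      \<comment> \<open>Conjugation preserves skewness, so the failure already occurs before
        conjugating and appears at an index where \<open>f i < g i\<close>.\<close>
      then have "\<not> is_skew (seq f 1 m) (seq g 1 m)" using is_skew_conj_seq by blast
      then obtain i where "1 \<le> i" "\<not> part (seq g 1 m) i \<le> part (seq f 1 m) i"
        using fp gp unfolding is_skew_def contained_def by blast
      then have "i \<in> {1..m}" "f i < g i" by (auto simp: part_seq split: if_splits)
      then show ?thesis using False zero by (simp add: S_def)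
    qed
  qed
qed

lemma inj_image_Diff_ends:
  fixes h :: "nat \<Rightarrow> nat"
  assumes "inj_on h {1..k + 1}" "1 \<le> k"
  shows "h ` {1..k + 1} - {h (k + 1)} = h ` {1..k}"
    and "h ` {1..k + 1} - {h 1} = h ` {2..k + 1}"
    and "h ` {1..k + 1} - {h (k + 1), h 1} = h ` {2..k}"
proof -
  have *: "h ` {1..k + 1} - h ` B = h ` ({1..k + 1} - B)" if "B \<subseteq> {1..k + 1}" for B
    using assms(1) that by (simp add: inj_on_image_set_diff)
  have "{1..k + 1} - {k + 1} = {1..k}" "{1..k + 1} - {1} = {2..k + 1}"
    "{1..k + 1} - {k + 1, 1} = {2..k}" using assms(2) by auto
  then show "h ` {1..k + 1} - {h (k + 1)} = h ` {1..k}"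
    "h ` {1..k + 1} - {h 1} = h ` {2..k + 1}"
    "h ` {1..k + 1} - {h (k + 1), h 1} = h ` {2..k}"
    using *[of "{k + 1}"] *[of "{1}"] *[of "{k + 1, 1}"] by auto
qed

lemma image_Suc_shift:
  "(\<lambda>i. h (Suc i)) ` {1..k} = h ` {2..k + 1}"
proof -
  have "Suc ` {1..k} = {2..k + 1}"
    by (simp add: image_Suc_atLeastAtMost numeral_2_eq_2 One_nat_def)
  then show ?thesis by (metis image_image)
qed

subsection \<open>The two identities\<close>

text \<open>Each change of the parts compensates a change of \<open>r\<close> or of the numbering,
  so all six factors are minors of \<open>U\<close> on rows from \<open>Q\<close> and columns from
  \<open>P\<close>, with the first or last index or both removed.\<close>

lemma dodgson_rows:
  fixes p q :: "nat \<Rightarrow> int"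
  assumes U: "gauss_upper X = U" "U \<in> carrier_mat N N" "upper_unitriangular U"
    and anti: "\<And>i j. 1 \<le> i \<Longrightarrow> i \<le> j \<Longrightarrow> p j \<le> p i" "\<And>i j. 1 \<le> i \<Longrightarrow> i \<le> j \<Longrightarrow> q j \<le> q i"
    and q0: "\<And>i. 0 \<le> q i" and qp: "\<And>i. q i \<le> p i" and pN: "\<And>i. p i + int r \<le> int N"
    and k: "1 \<le> k" "k + 1 \<le> r"
  shows "S X r (seq p 1 (k+1)) (seq q 1 (k+1)) * S X (r-1) (seq p 2 k) (seq q 2 k)
       = S X r (seq p 1 k) (seq q 1 k) * S X (r-1) (seq p 2 (k+1)) (seq q 2 (k+1))
       - S X r (seq (\<lambda>i. p i - 1) 2 (k+1)) (seq q 1 k)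
         * S X (r-1) (seq (\<lambda>i. p i + 1) 1 k) (seq q 2 (k+1))"
proof -
  define P where "P i = nat (p i + int r - int i)" for i
  define Q where "Q i = nat (q i + int r - int i)" for i
  have p0: "0 \<le> p i" for i using q0[of i] qp[of i] by simp
  have qN: "q i + int r \<le> int N" for i using qp[of i] pN[of i] by simp
  have rN: "r \<le> N" using p0[of 0] pN[of 0] by simp
  have r1: "int (r - 1) = int r - 1" using k by simp
  have seq2: "seq h 2 (k+1) = seq (\<lambda>i. h (Suc i)) 1 k" "seq h 2 k = seq (\<lambda>i. h (Suc i)) 1 (k-1)" for h
    using seq_Suc[of h 1 k] seq_Suc[of h 1 "k-1"] k by (simp_all add: numeral_2_eq_2 One_nat_def)
  \<comment> \<open>Omitting the first part and lowering \<open>r\<close> by 1 does not change the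
    indices: \<open>(r - 1) - i = r - (i + 1)\<close>.\<close>
  have im: "(\<lambda>i. nat (h (Suc i) + (int r - 1) - int i)) ` {1..k} = (\<lambda>i. nat (h i + int r - int i)) ` {2..k+1}"
    "(\<lambda>i. nat (h (Suc i) + (int r - 1) - int i)) ` {1..k-1} = (\<lambda>i. nat (h i + int r - int i)) ` {2..k}"
    for h :: "nat \<Rightarrow> int"
    using image_Suc_shift[of "\<lambda>i. nat (h i + int r - int i)" k]
      image_Suc_shift[of "\<lambda>i. nat (h i + int r - int i)" "k-1"] k
    by (simp_all add: algebra_simps)
  have b: "0 \<le> p i + int r - int i \<and> p i + int r \<le> int N" "0 \<le> q i \<and> q i + int r \<le> int N"
    if "i \<in> {1..k+1}" for i
    using p0[of i] pN[of i] q0[of i] qN[of i] that k by auto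
  have "S X r (seq p 1 (k+1)) (seq q 1 (k+1)) = subdet U (Q ` {1..k+1}) (P ` {1..k+1})"
    unfolding P_def Q_def
  proof (rule S_rows[OF U])
    show "\<forall>i\<in>{1..k+1}. 0 \<le> p i + int r - int i \<and> p i + int r \<le> int N"
      "\<forall>i\<in>{1..k+1}. 0 \<le> q i \<and> q i + int r \<le> int N"
      using b by blast+
  qed (use k rN in \<open>auto intro!: anti\<close>)
  moreover have "S X r (seq p 1 k) (seq q 1 k) = subdet U (Q ` {1..k}) (P ` {1..k})"
    unfolding P_def Q_def
  proof (rule S_rows[OF U])
    show "\<forall>i\<in>{1..k}. 0 \<le> p i + int r - int i \<and> p i + int r \<le> int N"
      "\<forall>i\<in>{1..k}. 0 \<le> q i \<and> q i + int r \<le> int N"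
      using b by simp_all
  qed (use k rN in \<open>auto intro!: anti\<close>)
  moreover have "S X (r-1) (seq p 2 k) (seq q 2 k) = subdet U (Q ` {2..k}) (P ` {2..k})"
    unfolding P_def Q_def seq2(2) im(2)[symmetric] r1[symmetric]
  proof (rule S_rows[OF U])
    show "\<forall>i\<in>{1..k-1}. 0 \<le> p (Suc i) + int (r - 1) - int i \<and> p (Suc i) + int (r - 1) \<le> int N"
    proof
      fix i assume "i \<in> {1..k-1}"
      then show "0 \<le> p (Suc i) + int (r - 1) - int i \<and> p (Suc i) + int (r - 1) \<le> int N"
        using p0[of "Suc i"] pN[of "Suc i"] k by auto
    qed
    show "\<forall>i\<in>{1..k-1}. 0 \<le> q (Suc i) \<and> q (Suc i) + int (r - 1) \<le> int N"
    proof
      fix i assume "i \<in> {1..k-1}"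
      then show "0 \<le> q (Suc i) \<and> q (Suc i) + int (r - 1) \<le> int N"
        using q0[of "Suc i"] qN[of "Suc i"] k by auto
    qed
  qed (use k rN in \<open>auto intro!: anti\<close>)
  moreover have "S X (r-1) (seq p 2 (k+1)) (seq q 2 (k+1)) = subdet U (Q ` {2..k+1}) (P ` {2..k+1})"
    unfolding P_def Q_def seq2(1) im(1)[symmetric] r1[symmetric]
  proof (rule S_rows[OF U])
    show "\<forall>i\<in>{1..k}. 0 \<le> p (Suc i) + int (r - 1) - int i \<and> p (Suc i) + int (r - 1) \<le> int N"
    proof
      fix i assume "i \<in> {1..k}"
      then show "0 \<le> p (Suc i) + int (r - 1) - int i \<and> p (Suc i) + int (r - 1) \<le> int N"
        using p0[of "Suc i"] pN[of "Suc i"] k by auto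
    qed
    show "\<forall>i\<in>{1..k}. 0 \<le> q (Suc i) \<and> q (Suc i) + int (r - 1) \<le> int N"
    proof
      fix i assume "i \<in> {1..k}"
      then show "0 \<le> q (Suc i) \<and> q (Suc i) + int (r - 1) \<le> int N"
        using q0[of "Suc i"] qN[of "Suc i"] k by auto
    qed
  qed (use k rN in \<open>auto intro!: anti\<close>)
  \<comment> \<open>Here \<open>r\<close> is kept, so lowering the parts by 1 absorbs the
    renumbering.\<close>
  moreover have "S X r (seq (\<lambda>i. p i - 1) 2 (k+1)) (seq q 1 k) = subdet U (Q ` {1..k}) (P ` {2..k+1})"
  proof -
    have "P ` {2..k+1} = (\<lambda>i. nat ((p (Suc i) - 1) + int r - int i)) ` {1..k}"
      unfolding P_def im(1)[symmetric] by (intro image_cong refl) simp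
    moreover have "S X r (seq (\<lambda>i. p (Suc i) - 1) 1 k) (seq q 1 k) =
        subdet U (Q ` {1..k}) ((\<lambda>i. nat ((p (Suc i) - 1) + int r - int i)) ` {1..k})"
      unfolding Q_def
    proof (rule S_rows[OF U])
      show "\<forall>i\<in>{1..k}. 0 \<le> p (Suc i) - 1 + int r - int i \<and> p (Suc i) - 1 + int r \<le> int N"
      proof
        fix i assume "i \<in> {1..k}"
        then show "0 \<le> p (Suc i) - 1 + int r - int i \<and> p (Suc i) - 1 + int r \<le> int N"
          using p0[of "Suc i"] pN[of "Suc i"] k by auto
      qed
      show "\<forall>i j. 1 \<le> i \<longrightarrow> i < j \<longrightarrow> j \<le> k \<longrightarrow> p (Suc j) - 1 \<le> p (Suc i) - 1"
        by (intro allI impI diff_right_mono anti) auto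
    qed (use k rN q0 qN in \<open>auto intro!: anti\<close>)
    ultimately show ?thesis by (simp only: seq2)
  qed
  \<comment> \<open>Here nothing is renumbered, and raising the parts by 1 makes up for
    \<open>r - 1\<close>.\<close>
  moreover have "S X (r-1) (seq (\<lambda>i. p i + 1) 1 k) (seq q 2 (k+1)) = subdet U (Q ` {2..k+1}) (P ` {1..k})"
  proof -
    have "P ` {1..k} = (\<lambda>i. nat ((p i + 1) + int (r - 1) - int i)) ` {1..k}"
      unfolding P_def r1 by (intro image_cong refl) simp
    moreover have "S X (r-1) (seq (\<lambda>i. p i + 1) 1 k) (seq (\<lambda>i. q (Suc i)) 1 k) =
        subdet U ((\<lambda>i. nat (q (Suc i) + int (r - 1) - int i)) ` {1..k})
          ((\<lambda>i. nat ((p i + 1) + int (r - 1) - int i)) ` {1..k})"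
    proof (rule S_rows[OF U])
      show "\<forall>i\<in>{1..k}. 0 \<le> p i + 1 + int (r - 1) - int i \<and> p i + 1 + int (r - 1) \<le> int N"
      proof
        fix i assume "i \<in> {1..k}"
        then show "0 \<le> p i + 1 + int (r - 1) - int i \<and> p i + 1 + int (r - 1) \<le> int N"
          using p0[of i] pN[of i] k by auto
      qed
      show "\<forall>i\<in>{1..k}. 0 \<le> q (Suc i) \<and> q (Suc i) + int (r - 1) \<le> int N"
      proof
        fix i assume "i \<in> {1..k}"
        then show "0 \<le> q (Suc i) \<and> q (Suc i) + int (r - 1) \<le> int N"
          using q0[of "Suc i"] qN[of "Suc i"] k by auto
      qed
    qed (use k rN in \<open>auto intro!: anti\<close>)
    ultimately show ?thesis unfolding seq2(1) Q_def im(1)[symmetric] r1[symmetric] by simp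
  qed
  moreover have "subdet U (Q ` {1..k+1}) (P ` {1..k+1}) * subdet U (Q ` {2..k}) (P ` {2..k}) =
      subdet U (Q ` {1..k}) (P ` {1..k}) * subdet U (Q ` {2..k+1}) (P ` {2..k+1}) -
      subdet U (Q ` {1..k}) (P ` {2..k+1}) * subdet U (Q ` {2..k+1}) (P ` {1..k})"
  proof -
    have less: "P j < P i" "Q j < Q i" if "1 \<le> i" "i < j" "j \<le> k + 1" for i j
      using anti(1)[of i j] anti(2)[of i j] p0[of j] q0[of j] k that unfolding P_def Q_def by auto
    have inj: "inj_on P {1..k+1}" "inj_on Q {1..k+1}"
      by (rule linorder_inj_onI', metis less atLeastAtMost_iff less_irrefl)+
    have sub: "P ` {1..k+1} \<subseteq> {..<N}" "Q ` {1..k+1} \<subseteq> {..<N}"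
    proof -
      have "P i < N" "Q i < N" if "i \<in> {1..k+1}" for i
        using pN[of i] qN[of i] that k rN unfolding P_def Q_def by auto
      then show "P ` {1..k+1} \<subseteq> {..<N}" "Q ` {1..k+1} \<subseteq> {..<N}" by auto
    qed
    have "card (Q ` {1..k+1}) = card (P ` {1..k+1})" using inj by (simp add: card_image)
    \<comment> \<open>\<open>P\<close> and \<open>Q\<close> are decreasing, so the smaller of the
      two deleted indices is the one at \<open>k + 1\<close>.\<close>
    from desnanot_jacobi_subdet[OF U(2) sub(2,1) this, of "Q (k+1)" "Q 1" "P (k+1)" "P 1"]
    show ?thesis using less[of 1 "k+1"] k
      by (simp add: inj_image_Diff_ends[OF inj(1) k(1), simplified]
        inj_image_Diff_ends[OF inj(2) k(1), simplified])
  qed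
  ultimately show ?thesis by simp
qed

lemma complement_image_Diff:
  fixes h :: "nat \<Rightarrow> nat"
  assumes "inj_on h {1..l + 1}" "1 \<le> l" "h ` {1..l + 1} \<subseteq> {..<n}"
  shows "({..<n} - h ` {2..l}) - {h 1} = {..<n} - h ` {1..l}"
    and "({..<n} - h ` {2..l}) - {h (l + 1)} = {..<n} - h ` {2..l + 1}"
    and "({..<n} - h ` {2..l}) - {h 1, h (l + 1)} = {..<n} - h ` {1..l + 1}"
    and "h 1 \<in> {..<n} - h ` {2..l}" "h (l + 1) \<in> {..<n} - h ` {2..l}"
proof -
  have "{1..l} = insert 1 {2..l}" "{2..l + 1} = insert (l + 1) {2..l}"
    "{1..l + 1} = insert 1 (insert (l + 1) {2..l})" using assms(2) by auto
  then show "({..<n} - h ` {2..l}) - {h 1} = {..<n} - h ` {1..l}"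
    "({..<n} - h ` {2..l}) - {h (l + 1)} = {..<n} - h ` {2..l + 1}"
    "({..<n} - h ` {2..l}) - {h 1, h (l + 1)} = {..<n} - h ` {1..l + 1}" by auto
  have "h 1 \<noteq> h i" "h (l + 1) \<noteq> h i" if "i \<in> {2..l}" for i
    using inj_onD[OF assms(1), of 1 i] inj_onD[OF assms(1), of "l + 1" i] that assms(2) by auto
  moreover have "h 1 < n" "h (l + 1) < n" using assms(2,3) by (auto simp: image_subset_iff)
  ultimately show "h 1 \<in> {..<n} - h ` {2..l}" "h (l + 1) \<in> {..<n} - h ` {2..l}" by blast+
qed

text \<open>In the complementary description, removing parts enlarges the minor. Thus the full
  matrix belongs to the parts 2 to \<open>l\<close>, and its doubly deleted submatrix to all
  \<open>l + 1\<close> parts.\<close>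

lemma dodgson_columns:
  fixes p q :: "nat \<Rightarrow> int"
  assumes U: "gauss_upper X = U" "U \<in> carrier_mat N N" "upper_unitriangular U"
    and anti: "\<And>i j. 1 \<le> i \<Longrightarrow> i \<le> j \<Longrightarrow> p j \<le> p i" "\<And>i j. 1 \<le> i \<Longrightarrow> i \<le> j \<Longrightarrow> q j \<le> q i"
    and q0: "\<And>i. 0 \<le> q i" and qp: "\<And>i. q i \<le> p i" and pr: "\<And>i. p i \<le> int r"
    and l: "1 \<le> l" "r + l + 1 \<le> N"
  shows "S X r (conj_seq (seq p 1 (l+1))) (conj_seq (seq q 1 (l+1)))
         * S X (r+1) (conj_seq (seq p 2 l)) (conj_seq (seq q 2 l))
       = S X r (conj_seq (seq p 1 l)) (conj_seq (seq q 1 l))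
         * S X (r+1) (conj_seq (seq p 2 (l+1))) (conj_seq (seq q 2 (l+1)))
       - S X r (conj_seq (seq (\<lambda>i. p i - 1) 2 (l+1))) (conj_seq (seq q 1 l))
         * S X (r+1) (conj_seq (seq (\<lambda>i. p i + 1) 1 l)) (conj_seq (seq q 2 (l+1)))"
proof -
  \<comment> \<open>The smallest frame for \<open>l + 1\<close> parts at \<open>r\<close>, and
    equally for \<open>l\<close> parts at \<open>r + 1\<close>.\<close>
  define n where "n = r + l + 1"
  define P where "P i = nat (int r + int i - 1 - p i)" for i
  define Q where "Q i = nat (int r + int i - 1 - q i)" for i
  have p0: "0 \<le> p i" for i using q0[of i] qp[of i] by simp
  have qr: "q i \<le> int r" for i using qp[of i] pr[of i] by simp
  have nN: "n \<le> N" using l unfolding n_def by simp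
  have seq2: "seq h 2 (l+1) = seq (\<lambda>i. h (Suc i)) 1 l" "seq h 2 l = seq (\<lambda>i. h (Suc i)) 1 (l-1)" for h
    using seq_Suc[of h 1 l] seq_Suc[of h 1 "l-1"] l by (simp_all add: numeral_2_eq_2 One_nat_def)
  \<comment> \<open>Omitting the first part and raising \<open>r\<close> by 1 keeps the deleted
    numbers: \<open>(r + 1) + i = r + (i + 1)\<close>.\<close>
  have im: "(\<lambda>i. nat (int (r + 1) + int i - 1 - h (Suc i))) ` {1..l} =
      (\<lambda>i. nat (int r + int i - 1 - h i)) ` {2..l+1}"
    "(\<lambda>i. nat (int (r + 1) + int i - 1 - h (Suc i))) ` {1..l-1} =
      (\<lambda>i. nat (int r + int i - 1 - h i)) ` {2..l}"
    for h :: "nat \<Rightarrow> int"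
    using image_Suc_shift[of "\<lambda>i. nat (int r + int i - 1 - h i)" l]
      image_Suc_shift[of "\<lambda>i. nat (int r + int i - 1 - h i)" "l-1"] l
    by (simp_all add: algebra_simps)
  have b: "p i \<le> int r \<and> int r + int i - 1 - p i < int n" "0 \<le> q i \<and> q i \<le> int r" if "i \<in> {1..l+1}" for i
    using pr[of i] p0[of i] q0[of i] qr[of i] that unfolding n_def by auto
  have b': "p (Suc i) \<le> int (r + 1) \<and> int (r + 1) + int i - 1 - p (Suc i) < int n"
    "0 \<le> q (Suc i) \<and> q (Suc i) \<le> int (r + 1)"
    "p (Suc i) - 1 \<le> int r \<and> int r + int i - 1 - (p (Suc i) - 1) < int n"
    "p i + 1 \<le> int (r + 1) \<and> int (r + 1) + int i - 1 - (p i + 1) < int n"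
    if "i \<in> {1..l}" for i
    using pr[of i] p0[of i] pr[of "Suc i"] p0[of "Suc i"] q0[of "Suc i"] qr[of "Suc i"] that
    unfolding n_def by auto
  have "S X r (conj_seq (seq p 1 (l+1))) (conj_seq (seq q 1 (l+1))) =
      subdet U ({..<n} - Q ` {1..l+1}) ({..<n} - P ` {1..l+1})"
    unfolding P_def Q_def
    by (rule S_columns[OF U]; use b nN n_def in \<open>auto intro!: anti\<close>)
  moreover have "S X r (conj_seq (seq p 1 l)) (conj_seq (seq q 1 l)) =
      subdet U ({..<n} - Q ` {1..l}) ({..<n} - P ` {1..l})"
    unfolding P_def Q_def
    by (rule S_columns[OF U]; use b nN n_def in \<open>auto intro!: anti\<close>)
  moreover have "S X (r+1) (conj_seq (seq p 2 l)) (conj_seq (seq q 2 l)) =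
      subdet U ({..<n} - Q ` {2..l}) ({..<n} - P ` {2..l})"
    unfolding P_def Q_def seq2(2) im(2)[symmetric]
  proof (rule S_columns[OF U])
    show "\<forall>i\<in>{1..l-1}. p (Suc i) \<le> int (r + 1) \<and> int (r + 1) + int i - 1 - p (Suc i) < int n"
      "\<forall>i\<in>{1..l-1}. 0 \<le> q (Suc i) \<and> q (Suc i) \<le> int (r + 1)"
      using b'(1,2) by (meson atLeastAtMost_iff diff_le_self le_trans)+
  qed (use nN n_def l in \<open>auto intro!: anti\<close>)
  moreover have "S X (r+1) (conj_seq (seq p 2 (l+1))) (conj_seq (seq q 2 (l+1))) =
      subdet U ({..<n} - Q ` {2..l+1}) ({..<n} - P ` {2..l+1})"
    unfolding P_def Q_def seq2(1) im(1)[symmetric]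
  proof (rule S_columns[OF U])
    show "\<forall>i\<in>{1..l}. p (Suc i) \<le> int (r + 1) \<and> int (r + 1) + int i - 1 - p (Suc i) < int n"
      "\<forall>i\<in>{1..l}. 0 \<le> q (Suc i) \<and> q (Suc i) \<le> int (r + 1)"
      using b'(1,2) by blast+
  qed (use nN n_def l in \<open>auto intro!: anti\<close>)
  \<comment> \<open>As \<open>r\<close> is unchanged, subtracting 1 from the parts accounts for the
    renumbering; in the next factor, adding 1 to the parts cancels the increase of
    \<open>r\<close>.\<close>
  moreover have "S X r (conj_seq (seq (\<lambda>i. p i - 1) 2 (l+1))) (conj_seq (seq q 1 l)) =
      subdet U ({..<n} - Q ` {1..l}) ({..<n} - P ` {2..l+1})"
  proof -
    have "P ` {2..l+1} = (\<lambda>i. nat (int r + int i - 1 - (p (Suc i) - 1))) ` {1..l}"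
      unfolding P_def im(1)[symmetric] by (intro image_cong refl) simp
    moreover have "S X r (conj_seq (seq (\<lambda>i. p (Suc i) - 1) 1 l)) (conj_seq (seq q 1 l)) =
        subdet U ({..<n} - Q ` {1..l}) ({..<n} - (\<lambda>i. nat (int r + int i - 1 - (p (Suc i) - 1))) ` {1..l})"
      unfolding Q_def
    proof (rule S_columns[OF U])
      show "\<forall>i\<in>{1..l}. p (Suc i) - 1 \<le> int r \<and> int r + int i - 1 - (p (Suc i) - 1) < int n"
        using b'(3) by blast
      show "\<forall>i\<in>{1..l}. 0 \<le> q i \<and> q i \<le> int r"
        using q0 qr by blast
      show "\<forall>i j. 1 \<le> i \<longrightarrow> i < j \<longrightarrow> j \<le> l \<longrightarrow> p (Suc j) - 1 \<le> p (Suc i) - 1"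
        by (intro allI impI diff_right_mono anti) auto
    qed (use nN n_def l in \<open>auto intro!: anti\<close>)
    ultimately show ?thesis by (simp only: seq2)
  qed
  moreover have "S X (r+1) (conj_seq (seq (\<lambda>i. p i + 1) 1 l)) (conj_seq (seq q 2 (l+1))) =
      subdet U ({..<n} - Q ` {2..l+1}) ({..<n} - P ` {1..l})"
  proof -
    have "P ` {1..l} = (\<lambda>i. nat (int (r + 1) + int i - 1 - (p i + 1))) ` {1..l}"
      unfolding P_def by (intro image_cong refl) simp
    moreover have "S X (r+1) (conj_seq (seq (\<lambda>i. p i + 1) 1 l)) (conj_seq (seq (\<lambda>i. q (Suc i)) 1 l)) =
        subdet U ({..<n} - (\<lambda>i. nat (int (r + 1) + int i - 1 - q (Suc i))) ` {1..l})
          ({..<n} - (\<lambda>i. nat (int (r + 1) + int i - 1 - (p i + 1))) ` {1..l})"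
    proof (rule S_columns[OF U])
      show "\<forall>i\<in>{1..l}. p i + 1 \<le> int (r + 1) \<and> int (r + 1) + int i - 1 - (p i + 1) < int n"
        "\<forall>i\<in>{1..l}. 0 \<le> q (Suc i) \<and> q (Suc i) \<le> int (r + 1)"
        using b'(2,4) by blast+
    qed (use nN n_def l in \<open>auto intro!: anti\<close>)
    ultimately show ?thesis unfolding seq2(1) Q_def im(1)[symmetric] by (simp only:)
  qed
  moreover have "subdet U ({..<n} - Q ` {2..l}) ({..<n} - P ` {2..l}) *
      subdet U ({..<n} - Q ` {1..l+1}) ({..<n} - P ` {1..l+1}) =
      subdet U ({..<n} - Q ` {1..l}) ({..<n} - P ` {1..l}) *
      subdet U ({..<n} - Q ` {2..l+1}) ({..<n} - P ` {2..l+1}) -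
      subdet U ({..<n} - Q ` {1..l}) ({..<n} - P ` {2..l+1}) *
      subdet U ({..<n} - Q ` {2..l+1}) ({..<n} - P ` {1..l})"
  proof -
    have less: "P i < P j" "Q i < Q j" if "1 \<le> i" "i < j" for i j
      using anti(1)[of i j] anti(2)[of i j] pr[of i] qr[of i] that unfolding P_def Q_def by auto
    have inj: "inj_on P {1..l+1}" "inj_on Q {1..l+1}"
      by (rule linorder_inj_onI', metis less atLeastAtMost_iff less_irrefl)+
    have sub: "P ` {1..l+1} \<subseteq> {..<n}" "Q ` {1..l+1} \<subseteq> {..<n}"
    proof -
      have "P i < n" "Q i < n" if "i \<in> {1..l+1}" for i
        using p0[of i] q0[of i] that unfolding P_def Q_def n_def by auto
      then show "P ` {1..l+1} \<subseteq> {..<n}" "Q ` {1..l+1} \<subseteq> {..<n}" by auto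
    qed
    note cP = complement_image_Diff[OF inj(1) l(1) sub(1)]
    note cQ = complement_image_Diff[OF inj(2) l(1) sub(2)]
    have s2: "P ` {2..l} \<subseteq> {..<n}" "Q ` {2..l} \<subseteq> {..<n}"
      "inj_on P {2..l}" "inj_on Q {2..l}"
      using sub inj by (auto simp: image_subset_iff intro: inj_on_subset)
    then have "card ({..<n} - Q ` {2..l}) = card ({..<n} - P ` {2..l})"
      by (simp add: card_Diff_subset card_image)
    moreover have "{..<n} - Q ` {2..l} \<subseteq> {..<N}" "{..<n} - P ` {2..l} \<subseteq> {..<N}" using nN by auto
    ultimately show ?thesis
      \<comment> \<open>\<open>P\<close> and \<open>Q\<close> increase here, so the smaller deleted
        index is the one at 1.\<close>
      using desnanot_jacobi_subdet[OF U(2), of "{..<n} - Q ` {2..l}" "{..<n} - P ` {2..l}"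
          "Q 1" "Q (l+1)" "P 1" "P (l+1)"] cP(4,5) cQ(4,5) less[of 1 "l+1"] l
      unfolding cP(1-3) cQ(1-3) by simp
  qed
  ultimately show ?thesis by (simp only: mult.commute)
qed

section \<open>Bounds from definedness and conclusion\<close>

lemma is_skew_part:
  assumes "is_skew lam mu"
  shows "1 \<le> i \<Longrightarrow> i \<le> j \<Longrightarrow> part lam j \<le> part lam i" "1 \<le> i \<Longrightarrow> i \<le> j \<Longrightarrow> part mu j \<le> part mu i"
    "0 \<le> part mu i" "part mu i \<le> part lam i"
proof -
  have p: "is_partition lam" "is_partition mu" and c: "\<And>i. 1 \<le> i \<Longrightarrow> part mu i \<le> part lam i"
    using assms unfolding is_skew_def contained_def by auto
  show "1 \<le> i \<Longrightarrow> i \<le> j \<Longrightarrow> part lam j \<le> part lam i" "1 \<le> i \<Longrightarrow> i \<le> j \<Longrightarrow> part mu j \<le> part mu i"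
    "0 \<le> part mu i" using p part_antimono part_nonneg by blast+
  show "part mu i \<le> part lam i"
    using c[of i] by (cases "1 \<le> i") (auto simp: part_def)
qed

text \<open>The last factor of the identities is always a genuine skew shape, because
  \<open>\<mu>_(i+1) \<le> \<mu>_i \<le> \<lambda>_i\<close>. Its definedness therefore yields an
  actual containment in a rectangle.\<close>

lemma is_skew_shifted:
  assumes "is_skew lam mu" "1 \<le> k"
  shows "is_skew (seq (\<lambda>i. part lam i + 1) 1 k) (seq (part mu) 2 (k + 1))"
proof -
  note s = is_skew_part[OF assms(1)]
  have "seq (part mu) 2 (k + 1) = seq (\<lambda>i. part mu (Suc i)) 1 k"
    using seq_Suc[of "part mu" 1 k] by (simp add: numeral_2_eq_2 One_nat_def)
  moreover have "part mu (Suc i) \<le> part lam i + 1" if "1 \<le> i" for i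
    using s(2)[OF that, of "Suc i"] s(4)[of i] by simp
  moreover have "0 \<le> part lam i" for i using s(3,4) order_trans by blast
  ultimately show ?thesis
    using s(1-3) by (auto simp: is_skew_def contained_def part_seq is_partition_seq)
qed

lemma part_replicate: "part (replicate r c) i = (if 1 \<le> i \<and> i \<le> r then c else 0)"
  by (auto simp: part_def)

text \<open>The raised sequence has \<open>k\<close> positive parts, which must fit into
  \<open>r - 1\<close> rows, and its first part \<open>\<lambda>_1 + 1\<close> is at most
  \<open>N - (r - 1)\<close>.\<close>

lemma rows_defined_bounds:
  assumes "is_skew lam mu" "1 \<le> k" "1 \<le> r" "r \<le> N"
    and "S_defined N (r-1) (seq (\<lambda>i. part lam i + 1) 1 k) (seq (part mu) 2 (k+1))"
  shows "k + 1 \<le> r" "part lam i + int r \<le> int N"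
proof -
  note s = is_skew_part[OF assms(1)]
  have p0: "0 \<le> part lam i" for i using s(3,4) order_trans by blast
  have "contained (seq (\<lambda>i. part lam i + 1) 1 k) (replicate (r-1) (int (N - (r-1))))"
    using assms(5) is_skew_shifted[OF assms(1,2)] unfolding S_defined_def by blast
  then have c: "1 \<le> i \<Longrightarrow> i \<le> k \<Longrightarrow> part lam i + 1 \<le> (if i \<le> r - 1 then int (N - (r-1)) else 0)" for i
    unfolding contained_def part_seq part_replicate by auto
  show kr: "k + 1 \<le> r" using c[of k] p0[of k] assms(2,3) by (auto split: if_splits)
  have p1: "part lam 1 + int r \<le> int N"
    using c[of 1] kr assms(2,3,4) by (auto split: if_splits simp: of_nat_diff)
  show "part lam i + int r \<le> int N"
  proof (cases "1 \<le> i")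
    case True
    then show ?thesis using s(1)[of 1 i] p1 by simp
  next
    case False
    then have "part lam i = 0" by (simp add: part_def)
    then show ?thesis using p1 p0[of 1] by simp
  qed
qed

text \<open>The conjugate of the raised sequence has first part at least \<open>l\<close>, bounded
  by \<open>N - (r + 1)\<close>, and at most \<open>r + 1\<close> nonzero parts, which bounds
  \<open>\<lambda>_1 + 1\<close>.\<close>

lemma columns_defined_bounds:
  assumes "is_skew lam mu" "1 \<le> l"
    and "S_defined N (r+1) (conj_seq (seq (\<lambda>i. part lam i + 1) 1 l)) (conj_seq (seq (part mu) 2 (l+1)))"
  shows "r + l + 1 \<le> N" "part lam i \<le> int r"
proof -
  let ?F = "seq (\<lambda>i. part lam i + 1) 1 l"
  note s = is_skew_part[OF assms(1)]
  have p0: "0 \<le> part lam i" for i using s(3,4) order_trans by blast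
  note sk = is_skew_shifted[OF assms(1,2)]
  then have F: "is_partition ?F" by (simp add: is_skew_def)
  have r: "r + 1 \<le> N" and "contained (conj_seq ?F) (replicate (r+1) (int (N - (r+1))))"
    using assms(3) is_skew_conj_seq[OF sk] unfolding S_defined_def by blast+
  then have c: "1 \<le> i \<Longrightarrow> part (conj_seq ?F) i \<le> (if i \<le> r + 1 then int (N - (r+1)) else 0)" for i
    unfolding contained_def part_replicate by auto
  have "int l \<le> part (conj_seq ?F) 1"
    using le_part_conj_seq_iff[OF F, of 1 l] assms(2) p0[of l] by (simp add: part_seq)
  then show "r + l + 1 \<le> N" using c[of 1] r by simp
  have "\<not> int 1 \<le> part (conj_seq ?F) (r + 2)" using c[of "r + 2"] by simp
  then have p1: "part lam 1 \<le> int r"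
    using le_part_conj_seq_iff[OF F, of "r + 2" 1] assms(2) by (simp add: part_seq)
  show "part lam i \<le> int r"
  proof (cases "1 \<le> i")
    case True
    then show ?thesis using s(1)[of 1 i] p1 by simp
  next
    case False
    then show ?thesis by (simp add: part_def)
  qed
qed

theorem theorem3p2:
  fixes N k l r :: nat and lam mu :: "int list"
  assumes "N \<ge> 1" and "k \<ge> 1" and "l \<ge> 1"
    and "is_skew lam mu"
    and "length lam = k + 1" and "length mu = k + 1"
    and "length (conj_seq lam) \<le> l + 1" and "length (conj_seq mu) \<le> l + 1"
  shows
    "let X = generic_mat N;
         p = part lam; q = part mu;
         p' = part (conj_seq lam); q' = part (conj_seq mu)
     in
      (r \<ge> 1 \<and>
       S_defined N r (seq p 1 (k+1)) (seq q 1 (k+1)) \<and>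
       S_defined N (r-1) (seq p 2 k) (seq q 2 k) \<and>
       S_defined N r (seq p 1 k) (seq q 1 k) \<and>
       S_defined N (r-1) (seq p 2 (k+1)) (seq q 2 (k+1)) \<and>
       S_defined N r (seq (\<lambda>i. p i - 1) 2 (k+1)) (seq q 1 k) \<and>
       S_defined N (r-1) (seq (\<lambda>i. p i + 1) 1 k) (seq q 2 (k+1))
       \<longrightarrow>
       S X r (seq p 1 (k+1)) (seq q 1 (k+1)) * S X (r-1) (seq p 2 k) (seq q 2 k)
       = S X r (seq p 1 k) (seq q 1 k) * S X (r-1) (seq p 2 (k+1)) (seq q 2 (k+1))
       - S X r (seq (\<lambda>i. p i - 1) 2 (k+1)) (seq q 1 k)
         * S X (r-1) (seq (\<lambda>i. p i + 1) 1 k) (seq q 2 (k+1)))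
      \<and>
      (S_defined N r (conj_seq (seq p' 1 (l+1))) (conj_seq (seq q' 1 (l+1))) \<and>
       S_defined N (r+1) (conj_seq (seq p' 2 l)) (conj_seq (seq q' 2 l)) \<and>
       S_defined N r (conj_seq (seq p' 1 l)) (conj_seq (seq q' 1 l)) \<and>
       S_defined N (r+1) (conj_seq (seq p' 2 (l+1))) (conj_seq (seq q' 2 (l+1))) \<and>
       S_defined N r (conj_seq (seq (\<lambda>i. p' i - 1) 2 (l+1))) (conj_seq (seq q' 1 l)) \<and>
       S_defined N (r+1) (conj_seq (seq (\<lambda>i. p' i + 1) 1 l)) (conj_seq (seq q' 2 (l+1)))
       \<longrightarrow>
       S X r (conj_seq (seq p' 1 (l+1))) (conj_seq (seq q' 1 (l+1)))
         * S X (r+1) (conj_seq (seq p' 2 l)) (conj_seq (seq q' 2 l))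
       = S X r (conj_seq (seq p' 1 l)) (conj_seq (seq q' 1 l))
         * S X (r+1) (conj_seq (seq p' 2 (l+1))) (conj_seq (seq q' 2 (l+1)))
       - S X r (conj_seq (seq (\<lambda>i. p' i - 1) 2 (l+1))) (conj_seq (seq q' 1 l))
         * S X (r+1) (conj_seq (seq (\<lambda>i. p' i + 1) 1 l)) (conj_seq (seq q' 2 (l+1))))"
proof -
  define X where "X = generic_mat N"
  note U = refl[of "gauss_upper X"] gauss_upper_generic_mat[of N, folded X_def]
  note s = is_skew_part[OF assms(4)]
  have sk': "is_skew (conj_seq lam) (conj_seq mu)" using assms(4) by (rule is_skew_conj_seq)
  note s' = is_skew_part[OF sk']
  show ?thesis
    unfolding Let_def X_def[symmetric]
  proof (intro conjI impI; elim conjE)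
    assume d: "1 \<le> r" "S_defined N r (seq (part lam) 1 (k+1)) (seq (part mu) 1 (k+1))"
      "S_defined N (r-1) (seq (\<lambda>i. part lam i + 1) 1 k) (seq (part mu) 2 (k+1))"
    then have "r \<le> N" by (simp add: S_defined_def)
    \<comment> \<open>The factor with the raised parts supplies the bounds needed to keep every
      index inside the matrix.\<close>
    note b = rows_defined_bounds[OF assms(4,2) d(1) this d(3)]
    show "S X r (seq (part lam) 1 (k+1)) (seq (part mu) 1 (k+1)) *
        S X (r-1) (seq (part lam) 2 k) (seq (part mu) 2 k) =
      S X r (seq (part lam) 1 k) (seq (part mu) 1 k) *
        S X (r-1) (seq (part lam) 2 (k+1)) (seq (part mu) 2 (k+1)) -
      S X r (seq (\<lambda>i. part lam i - 1) 2 (k+1)) (seq (part mu) 1 k) *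
        S X (r-1) (seq (\<lambda>i. part lam i + 1) 1 k) (seq (part mu) 2 (k+1))"
      by (rule dodgson_rows[OF U s(1,2) s(3) s(4) b(2) assms(2) b(1)])
  next
    let ?p = "part (conj_seq lam)" and ?q = "part (conj_seq mu)"
    assume "S_defined N (r+1) (conj_seq (seq (\<lambda>i. ?p i + 1) 1 l)) (conj_seq (seq ?q 2 (l+1)))"
    \<comment> \<open>Identity (2) is the column identity applied to the conjugate pair, which is
      again a skew shape.\<close>
    note b = columns_defined_bounds[OF sk' assms(3) this]
    show "S X r (conj_seq (seq ?p 1 (l+1))) (conj_seq (seq ?q 1 (l+1))) *
        S X (r+1) (conj_seq (seq ?p 2 l)) (conj_seq (seq ?q 2 l)) =
      S X r (conj_seq (seq ?p 1 l)) (conj_seq (seq ?q 1 l)) *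
        S X (r+1) (conj_seq (seq ?p 2 (l+1))) (conj_seq (seq ?q 2 (l+1))) -
      S X r (conj_seq (seq (\<lambda>i. ?p i - 1) 2 (l+1))) (conj_seq (seq ?q 1 l)) *
        S X (r+1) (conj_seq (seq (\<lambda>i. ?p i + 1) 1 l)) (conj_seq (seq ?q 2 (l+1)))"
      by (rule dodgson_columns[OF U s'(1,2) s'(3) s'(4) b(2) assms(3) b(1)])
  qed
qed

end
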